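(* Let $m\ge1$ and let $x_1,\dots,x_{2m}\in H$ satisfy $x_i=\overline{x}_i$ for $i=1,\dots,2m$. With $G_q(x)=d_q(x)+d_q^\ast(x)$ for $q\in(-1,1)$, $$\lim_{q\to1^-}\langle\Omega,G_q(x_1)\cdots G_q(x_{2m})\Omega\rangle_q=\sum_{\pi\in\mathcal{P}_2(2m)}2^{\,m-\mathrm{out}(\pi)}\prod_{\{i<j\}\in\pi}\langle x_i,x_j\rangle .$$
   Context: Fock space. $H$ is a complex Hilbert space with inner product $\langle\cdot,\cdot\rangle$ linear in the right argument and antilinear in the left one; $x\mapsto\overline{x}$ is a fixed selfadjoint involution on $H$, i.e. a bounded selfadjoint linear operator whose square is the identity. Let $B(n)$ be the group of permutations $\sigma$ of $\{\pm1,\dots,\pm n\}$ with $\sigma(-k)=-\sigma(k)$; put $\pi_i=(i,i+1)(-i,-i-1)$ for $1\le i\le n-1$, $\overline{\pi}_n=(n,-n)$ and $\widehat{\pi}_{n-1}=\overline{\pi}_n\pi_{n-1}\overline{\pi}_n$. The Coxeter group $D(n)$ of type D is $D(1)=\{e\}$ and, for $n\ge2$, the subgroup of $B(n)$ generated by $\pi_1,\dots,\pi_{n-1},\widehat{\pi}_{n-1}$; $\ell(\sigma)$ is the minimal number of these generators in a product expression of $\sigma\in D(n)$. For $n\ge 2$, $D(n)$ acts on $H^{\otimes n}$ by $\pi_i(x_1\otimes\cdots\otimes x_n)=x_1\otimes\cdots\otimes x_{i-1}\otimes x_{i+1}\otimes x_i\otimes x_{i+2}\otimes\cdots\otimes x_n$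 and $\widehat{\pi}_{n-1}(x_1\otimes\cdots\otimes x_n)=x_1\otimes\cdots\otimes x_{n-2}\otimes\overline{x}_n\otimes\overline{x}_{n-1}$; $D(1)$ acts trivially on $H$. Put $\widehat{P}_q^{(n)}=\sum_{\sigma\in D(n)}q^{\ell(\sigma)}\sigma$ for $n\ge1$ and $\widehat P_q^{(0)}=I$ (convention $0^0=1$). Let $\mathcal{F}_{\rm fin}(H)=\bigoplus_{n\ge0}H^{\otimes n}$ be the algebraic direct sum, $H^{\otimes0}=\mathbb{C}\Omega$ with $\Omega$ a unit vector, with the usual inner product $\langle x_1\otimes\cdots\otimes x_m,y_1\otimes\cdots\otimes y_n\rangle_0=\delta_{m,n}\prod_i\langle x_i,y_i\rangle$, and $\widehat P_q=\bigoplus_n\widehat P_q^{(n)}$. For $q\in(-1,1)$, $\widehat P_q$ is known to be strictly positive, so $\langle f,g\rangle_q:=\langle f,\widehat P_q g\rangle_0$ is an inner product. The creation operator is $d_q^\ast(x)(x_1\otimes\cdots\otimes x_n)=x\otimes x_1\otimes\cdots\otimes x_n$, $d_q^\ast(x)\Omega=x$, and $d_q(x)$ is its adjoint with respect to $\langle\cdot,\cdot\rangle_q$. Combinatorics. $\mathcal{P}_2(2m)$ is the set of pair partitions of $\{1,\dots,2m\}$. Two pairs $\{a<b\}$, $\{c<d\}$ cross if $a<c<b<d$ or $c<a<d<b$. Let $\sim$ be the equivalence relation on the blocks of $\pi$ generated by crossing; the connected components of $\pi$ are the unions of the blocks in each equivalence class. A set $A$ covers a set $B$ if there are $i,j\in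 A$ with $i<k<j$ for all $k\in B$. A connected component is outer if it is not covered by any other connected component; $\mathrm{out}(\pi)$ is the number of outer connected components of $\pi$. *)

theory Defs
  imports
    Complex_Main
    "HOL-Library.Poly_Mapping"
    "HOL-Library.Disjoint_Sets"
    "HOL-Combinatorics.Permutations"
    "HOL-Algebra.Generated_Groups"
begin

section \<open>Complex vector spaces and Hilbert spaces\<close>

class complex_vector = ab_group_add +
  fixes scaleC :: "complex \<Rightarrow> 'a \<Rightarrow> 'a"  (infixr \<open>*\<^sub>C\<close> 75)
  assumes scaleC_add_right: "c *\<^sub>C (x + y) = c *\<^sub>C x + c *\<^sub>C y"
    and scaleC_add_left: "(c + d) *\<^sub>C x = c *\<^sub>C x + d *\<^sub>C x"
    and scaleC_scaleC: "c *\<^sub>C (d *\<^sub>C x) = (c * d) *\<^sub>C x"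
    and scaleC_one: "1 *\<^sub>C x = x"

text \<open>Completeness comes from the class \<open>banach\<close>; positive definiteness of the inner
  product is part of \<open>cinner_self\<close>.\<close>

class complex_hilbert = complex_vector + banach +
  fixes cinner :: "'a \<Rightarrow> 'a \<Rightarrow> complex"
  assumes scaleR_eq_scaleC: "r *\<^sub>R x = complex_of_real r *\<^sub>C x"
    and cinner_commute: "cinner x y = cnj (cinner y x)"
    and cinner_add_right: "cinner x (y + z) = cinner x y + cinner x z"
    and cinner_scaleC_right: "cinner x (c *\<^sub>C y) = c * cinner x y"
    and cinner_self: "cinner x x = complex_of_real ((norm x)\<^sup>2)"

instantiation complex :: complex_hilbert
begin
definition "scaleC_complex = ((*) :: complex \<Rightarrow> complex \<Rightarrow> complex)"
definition "cinner_complex x y = cnj x * (y :: complex)"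
instance
  by standard (simp_all add: scaleC_complex_def cinner_complex_def algebra_simps
      scaleR_conv_of_real complex_norm_square flip: of_real_power)
end

definition clinear :: "('a::complex_vector \<Rightarrow> 'b::complex_vector) \<Rightarrow> bool" where
  "clinear f \<longleftrightarrow> (\<forall>x y. f (x + y) = f x + f y) \<and> (\<forall>c x. f (c *\<^sub>C x) = c *\<^sub>C f x)"

definition selfadjoint_involution :: "('a::complex_hilbert \<Rightarrow> 'a) \<Rightarrow> bool" where
  "selfadjoint_involution J \<longleftrightarrow>
     clinear J \<and> bounded_linear J \<and> (\<forall>x y. cinner (J x) y = cinner x (J y)) \<and> (\<forall>x. J (J x) = x)"

lemma scaleC_zero_left [simp]: "0 *\<^sub>C x = (0 :: 'a::complex_vector)"
  using scaleC_add_left[of 0 0 x] by simp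

lemma scaleC_zero_right [simp]: "c *\<^sub>C 0 = (0 :: 'a::complex_vector)"
  using scaleC_add_right[of c 0 0] by simp

lemma scaleC_minus_one: "(- 1) *\<^sub>C x = - (x :: 'a::complex_vector)"
proof -
  have "(- 1) *\<^sub>C x + x = ((- 1) + 1) *\<^sub>C x"
    by (simp only: scaleC_add_left scaleC_one)
  then show ?thesis by (simp add: eq_neg_iff_add_eq_0)
qed

lemma scaleC_minus_right: "c *\<^sub>C (- x) = - (c *\<^sub>C (x :: 'a::complex_vector))"
  using scaleC_add_right[of c x "- x"] by (simp add: eq_neg_iff_add_eq_0 add.commute)

lemma scaleC_diff_right: "c *\<^sub>C (x - y) = c *\<^sub>C x - c *\<^sub>C (y :: 'a::complex_vector)"
  by (metis add_uminus_conv_diff scaleC_add_right scaleC_minus_right)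

lemma scaleC_sum_right:
  "c *\<^sub>C sum f A = (\<Sum>a\<in>A. c *\<^sub>C (f a :: 'b::complex_vector))"
  by (induction A rule: infinite_finite_induct) (simp_all add: scaleC_add_right)

lemma clinearI:
  "(\<And>x y. f (x + y) = f x + f y) \<Longrightarrow> (\<And>c x. f (c *\<^sub>C x) = c *\<^sub>C f x) \<Longrightarrow> clinear f"
  by (simp add: clinear_def)

lemma clinear_add: "clinear f \<Longrightarrow> f (x + y) = f x + f y"
  and clinear_scaleC: "clinear f \<Longrightarrow> f (c *\<^sub>C x) = c *\<^sub>C f x"
  by (simp_all add: clinear_def)

lemma clinear_zero: "clinear f \<Longrightarrow> f 0 = 0"
  using clinear_scaleC[of f 0 0] by simp

lemma clinear_sum_scaleC:
  assumes "\<And>a. a \<in> A \<Longrightarrow> clinear (f a)"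
  shows "clinear (\<lambda>x. \<Sum>a\<in>A. c a *\<^sub>C f a x)"
proof (rule clinearI)
  fix x y
  have "(\<Sum>a\<in>A. c a *\<^sub>C f a (x + y)) = (\<Sum>a\<in>A. c a *\<^sub>C f a x + c a *\<^sub>C f a y)"
    by (intro sum.cong refl) (simp add: clinear_add[OF assms] scaleC_add_right)
  then show "(\<Sum>a\<in>A. c a *\<^sub>C f a (x + y)) = (\<Sum>a\<in>A. c a *\<^sub>C f a x) + (\<Sum>a\<in>A. c a *\<^sub>C f a y)"
    by (simp add: sum.distrib)
next
  fix d x
  show "(\<Sum>a\<in>A. c a *\<^sub>C f a (d *\<^sub>C x)) = d *\<^sub>C (\<Sum>a\<in>A. c a *\<^sub>C f a x)"
    unfolding scaleC_sum_right
    by (intro sum.cong refl)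
      (simp add: clinear_scaleC[OF assms] scaleC_scaleC mult.commute)
qed

lemma clinear_diff: "clinear f \<Longrightarrow> f (x - y) = f x - f y"
  by (metis add_diff_cancel clinear_add diff_add_cancel)


section \<open>The algebraic full Fock space\<close>

text \<open>The free complex vector space on all finite sequences in \<open>H\<close> modulo the relations of
  multilinearity in each entry. These relations only involve sequences of one common length, so
  the quotient is the algebraic direct sum of the algebraic tensor powers of \<open>H\<close>.\<close>

instantiation poly_mapping :: (type, complex_vector) complex_vector
begin

lift_definition scaleC_poly_mapping ::
  "complex \<Rightarrow> ('a \<Rightarrow>\<^sub>0 'b) \<Rightarrow> 'a \<Rightarrow>\<^sub>0 'b" is "\<lambda>c f k. c *\<^sub>C f k"
proof -
  fix c :: complex and f :: "'a \<Rightarrow> 'b"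
  assume "finite {k. f k \<noteq> 0}"
  then show "finite {k. c *\<^sub>C f k \<noteq> 0}"
    by (rule rev_finite_subset) auto
qed

instance
  by standard
    (transfer, simp add: fun_eq_iff scaleC_add_right scaleC_add_left scaleC_scaleC scaleC_one)+

end

inductive_set tensor_null :: "('a::complex_vector list \<Rightarrow>\<^sub>0 complex) set" where
  null_zero: "0 \<in> tensor_null"
| null_add: "f \<in> tensor_null \<Longrightarrow> g \<in> tensor_null \<Longrightarrow> f + g \<in> tensor_null"
| null_scaleC: "f \<in> tensor_null \<Longrightarrow> c *\<^sub>C f \<in> tensor_null"
| null_additive:
    "Poly_Mapping.single (us @ (x + y) # vs) 1
       - Poly_Mapping.single (us @ x # vs) 1 - Poly_Mapping.single (us @ y # vs) 1 \<in> tensor_null"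
| null_homogeneous:
    "Poly_Mapping.single (us @ (c *\<^sub>C x) # vs) 1
       - c *\<^sub>C Poly_Mapping.single (us @ x # vs) 1 \<in> tensor_null"

lemma null_minus: "f \<in> tensor_null \<Longrightarrow> - f \<in> tensor_null"
  using null_scaleC[of f "- 1"] by (simp add: scaleC_minus_one)

definition tensor_eq ::
  "('a::complex_vector list \<Rightarrow>\<^sub>0 complex) \<Rightarrow> ('a list \<Rightarrow>\<^sub>0 complex) \<Rightarrow> bool" where
  "tensor_eq f g \<longleftrightarrow> f - g \<in> tensor_null"

lemma equivp_tensor_eq: "equivp tensor_eq"
proof (rule equivpI)
  show "reflp tensor_eq" by (simp add: reflp_def tensor_eq_def null_zero)
  show "symp tensor_eq"
    unfolding symp_def tensor_eq_def using null_minus by fastforce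
  show "transp tensor_eq"
    unfolding transp_def tensor_eq_def using null_add by fastforce
qed

quotient_type (overloaded) 'a fock =
  "'a::complex_vector list \<Rightarrow>\<^sub>0 complex" / tensor_eq
  by (rule equivp_tensor_eq)

instantiation fock :: (complex_vector) complex_vector
begin

lift_definition zero_fock :: "'a fock" is 0 .

lift_definition plus_fock :: "'a fock \<Rightarrow> 'a fock \<Rightarrow> 'a fock" is "(+)"
  unfolding tensor_eq_def by (simp only: add_diff_add null_add)

lift_definition uminus_fock :: "'a fock \<Rightarrow> 'a fock" is uminus
  unfolding tensor_eq_def by (simp only: minus_diff_minus null_minus)

lift_definition minus_fock :: "'a fock \<Rightarrow> 'a fock \<Rightarrow> 'a fock" is "(-)"
proof -
  fix f f' g g' :: "'a list \<Rightarrow>\<^sub>0 complex"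
  assume "tensor_eq f f'" "tensor_eq g g'"
  then have "(f - f') + - (g - g') \<in> tensor_null"
    unfolding tensor_eq_def by (intro null_add null_minus)
  then show "tensor_eq (f - g) (f' - g')"
    by (simp add: tensor_eq_def algebra_simps)
qed

lift_definition scaleC_fock :: "complex \<Rightarrow> 'a fock \<Rightarrow> 'a fock" is scaleC
  unfolding tensor_eq_def by (simp only: null_scaleC flip: scaleC_diff_right)

instance
proof
  fix a b c :: "'a fock" and r s :: complex
  show "a + b + c = a + (b + c)"
    by transfer (simp add: tensor_eq_def null_zero add.assoc)
  show "a + b = b + a" by transfer (simp add: tensor_eq_def null_zero add.commute)
  show "0 + a = a" by transfer (simp add: tensor_eq_def null_zero)
  show "- a + a = 0" by transfer (simp add: tensor_eq_def null_zero)
  show "a - b = a + - b" by transfer (simp add: tensor_eq_def null_zero)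
  show "r *\<^sub>C (a + b) = r *\<^sub>C a + r *\<^sub>C b"
    by transfer (simp add: tensor_eq_def null_zero scaleC_add_right)
  show "(r + s) *\<^sub>C a = r *\<^sub>C a + s *\<^sub>C a"
    by transfer (simp add: tensor_eq_def null_zero scaleC_add_left)
  show "r *\<^sub>C (s *\<^sub>C a) = (r * s) *\<^sub>C a"
    by transfer (simp add: tensor_eq_def null_zero scaleC_scaleC)
  show "1 *\<^sub>C a = a" by transfer (simp add: tensor_eq_def null_zero scaleC_one)
qed

end

text \<open>\<open>tensor [x\<^sub>1, \<dots>, x\<^sub>n]\<close> is the elementary tensor of \<open>x\<^sub>1, \<dots>, x\<^sub>n\<close>.\<close>

lift_definition tensor :: "'a::complex_vector list \<Rightarrow> 'a fock" is "\<lambda>xs. Poly_Mapping.single xs 1" .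

definition vacuum :: "'a::complex_vector fock" where
  "vacuum = tensor []"

definition multilinear :: "('a::complex_vector list \<Rightarrow> 'b::complex_vector) \<Rightarrow> bool" where
  "multilinear \<phi> \<longleftrightarrow> (\<forall>us vs. clinear (\<lambda>x. \<phi> (us @ x # vs)))"

text \<open>The unique linear map with prescribed values on elementary tensors; it exists for
  multilinear \<open>\<phi>\<close> by \<open>lin_ext_ex1\<close>.\<close>

definition lin_ext :: "('a::complex_vector list \<Rightarrow> 'b::complex_vector) \<Rightarrow> 'a fock \<Rightarrow> 'b" where
  "lin_ext \<phi> = (THE T. clinear T \<and> (\<forall>xs. T (tensor xs) = \<phi> xs))"

lemma multilinear_tensor: "multilinear tensor"
proof -
  have "tensor (us @ (x + y) # vs) = tensor (us @ x # vs) + tensor (us @ y # vs)"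
    for us vs :: "'a list" and x y
    by transfer (use null_additive in \<open>simp add: tensor_eq_def diff_diff_eq\<close>)
  moreover have "tensor (us @ (c *\<^sub>C x) # vs) = c *\<^sub>C tensor (us @ x # vs)"
    for us vs :: "'a list" and x c
    by transfer (use null_homogeneous in \<open>simp add: tensor_eq_def\<close>)
  ultimately show ?thesis by (simp add: multilinear_def clinear_def)
qed

lemma fock_abs_cases:
  obtains g where "f = abs_fock g"
  using Quotient3_abs_rep[OF Quotient3_fock, of f] by metis

lemma fock_induct [case_names zero add scaleC tensor]:
  assumes zero: "P 0" and add: "\<And>f g. P f \<Longrightarrow> P g \<Longrightarrow> P (f + g)"
    and scaleC: "\<And>c f. P f \<Longrightarrow> P (c *\<^sub>C f)" and tensor: "\<And>xs. P (tensor xs)"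
  shows "P (f :: 'a::complex_vector fock)"
proof -
  have "P (abs_fock g)" for g :: "'a list \<Rightarrow>\<^sub>0 complex"
  proof (induction g rule: update_induct)
    case const
    then show ?case using zero by (simp add: zero_fock_def)
  next
    case (update g xs c)
    have "Poly_Mapping.update xs c g = g + c *\<^sub>C Poly_Mapping.single xs 1"
      using update(1)
      by transfer (auto simp: fun_eq_iff when_def scaleC_complex_def)
    then have "abs_fock (Poly_Mapping.update xs c g) = abs_fock g + c *\<^sub>C tensor xs"
      by (simp add: plus_fock.abs_eq scaleC_fock.abs_eq tensor.abs_eq)
    then show ?case using update add scaleC tensor by simp
  qed
  then show ?thesis by (cases f rule: fock_abs_cases) simp
qed

lemma clinear_fock_eqI:
  assumes "clinear S" "clinear T" "\<And>xs. S (tensor xs) = T (tensor xs)"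
  shows "S = T"
proof
  fix f show "S f = T f"
    by (induction f rule: fock_induct)
      (use assms in \<open>simp_all add: clinear_zero clinear_add clinear_scaleC\<close>)
qed

definition free_ext :: "('k \<Rightarrow> 'b::complex_vector) \<Rightarrow> ('k \<Rightarrow>\<^sub>0 complex) \<Rightarrow> 'b" where
  "free_ext \<phi> f = (\<Sum>k\<in>Poly_Mapping.keys f. Poly_Mapping.lookup f k *\<^sub>C \<phi> k)"

lemma free_ext_superset:
  assumes "finite K" "Poly_Mapping.keys f \<subseteq> K"
  shows "free_ext \<phi> f = (\<Sum>k\<in>K. Poly_Mapping.lookup f k *\<^sub>C \<phi> k)"
  unfolding free_ext_def using assms
  by (intro sum.mono_neutral_left) (auto simp: in_keys_iff)

lemma clinear_free_ext: "clinear (free_ext \<phi>)"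
proof (rule clinearI)
  fix f g :: "'a \<Rightarrow>\<^sub>0 complex"
  let ?K = "Poly_Mapping.keys f \<union> Poly_Mapping.keys g"
  show "free_ext \<phi> (f + g) = free_ext \<phi> f + free_ext \<phi> g"
    using keys_add[of f g]
    by (simp add: free_ext_superset[of ?K] lookup_add scaleC_add_left sum.distrib)
next
  fix c and f :: "'a \<Rightarrow>\<^sub>0 complex"
  have lookup: "Poly_Mapping.lookup (c *\<^sub>C f) k = c * Poly_Mapping.lookup f k" for k
    by transfer (simp add: scaleC_complex_def)
  have "Poly_Mapping.keys (c *\<^sub>C f) \<subseteq> Poly_Mapping.keys f"
    by (auto simp: in_keys_iff lookup)
  then show "free_ext \<phi> (c *\<^sub>C f) = c *\<^sub>C free_ext \<phi> f"
    by (simp add: free_ext_superset[of "Poly_Mapping.keys f"] lookup scaleC_sum_right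
        scaleC_scaleC)
qed

lemma free_ext_single: "free_ext \<phi> (Poly_Mapping.single k 1) = \<phi> k"
  by (simp add: free_ext_def scaleC_one)

lemma free_ext_null:
  assumes "multilinear \<phi>" "f \<in> tensor_null"
  shows "free_ext \<phi> f = 0"
  using assms(2)
proof induction
  case (null_additive us x y vs)
  then show ?case
    using assms(1) by (simp add: clinear_diff[OF clinear_free_ext] free_ext_single
        multilinear_def clinear_def)
next
  case (null_homogeneous us c x vs)
  then show ?case
    using assms(1) by (simp add: clinear_diff[OF clinear_free_ext]
        clinear_scaleC[OF clinear_free_ext] free_ext_single multilinear_def clinear_def)
qed (simp_all add: clinear_zero[OF clinear_free_ext] clinear_add[OF clinear_free_ext]
        clinear_scaleC[OF clinear_free_ext])

lemma lin_ext_ex1: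
  assumes "multilinear \<phi>"
  shows "\<exists>!T. clinear T \<and> (\<forall>xs. T (tensor xs) = \<phi> xs)"
proof (rule ex_ex1I)
  have resp: "free_ext \<phi> f = free_ext \<phi> g" if "tensor_eq f g" for f g
    using free_ext_null[OF assms, of "f - g"] that
    by (simp add: tensor_eq_def clinear_diff[OF clinear_free_ext])
  define T where "T f = free_ext \<phi> (rep_fock f)" for f
  have abs: "T (abs_fock f) = free_ext \<phi> f" for f
    unfolding T_def using resp Quotient3_rep_abs[OF Quotient3_fock] equivp_reflp[OF equivp_tensor_eq]
    by blast
  have "T (f + g) = T f + T g" for f g
    by (cases f rule: fock_abs_cases; cases g rule: fock_abs_cases)
      (simp add: plus_fock.abs_eq abs clinear_add[OF clinear_free_ext])
  moreover have "T (c *\<^sub>C f) = c *\<^sub>C T f" for c f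
    by (cases f rule: fock_abs_cases)
      (simp add: scaleC_fock.abs_eq abs clinear_scaleC[OF clinear_free_ext])
  ultimately show "\<exists>T. clinear T \<and> (\<forall>xs. T (tensor xs) = \<phi> xs)"
    by (intro exI[of _ T]) (simp add: clinear_def tensor.abs_eq abs free_ext_single)
qed (auto intro: clinear_fock_eqI)

lemma
  assumes "multilinear \<phi>"
  shows clinear_lin_ext: "clinear (lin_ext \<phi>)"
    and lin_ext_tensor: "lin_ext \<phi> (tensor xs) = \<phi> xs"
  using theI'[OF lin_ext_ex1[OF assms]] unfolding lin_ext_def by auto

definition sesquilinear :: "('a::complex_vector \<Rightarrow> 'a \<Rightarrow> complex) \<Rightarrow> bool" where
  "sesquilinear B \<longleftrightarrow> (\<forall>f. clinear (B f)) \<and>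
     (\<forall>f f' g. B (f + f') g = B f g + B f' g) \<and> (\<forall>c f g. B (c *\<^sub>C f) g = cnj c * B f g)"

definition tensor_inner :: "'a::complex_hilbert list \<Rightarrow> 'a list \<Rightarrow> complex" where
  "tensor_inner xs ys =
     (if length xs = length ys then \<Prod>i<length xs. cinner (xs ! i) (ys ! i) else 0)"

definition fock_inner_0 :: "'a::complex_hilbert fock \<Rightarrow> 'a fock \<Rightarrow> complex" where
  "fock_inner_0 =
     (THE B. sesquilinear B \<and> (\<forall>xs ys. B (tensor xs) (tensor ys) = tensor_inner xs ys))"

lemma tensor_inner_split:
  "tensor_inner xs (us @ y # vs) =
     (if length xs = Suc (length us + length vs)
      then cinner (xs ! length us) y *
        (\<Prod>i\<in>{..<length xs} - {length us}. cinner (xs ! i) ((us @ 0 # vs) ! i))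
      else 0)"
proof (cases "length xs = Suc (length us + length vs)")
  case True
  have "(\<Prod>i<length xs. cinner (xs ! i) ((us @ y # vs) ! i)) =
      cinner (xs ! length us) y *
        (\<Prod>i\<in>{..<length xs} - {length us}. cinner (xs ! i) ((us @ y # vs) ! i))"
    using True by (subst prod.remove[of _ "length us"]) auto
  also have "(\<Prod>i\<in>{..<length xs} - {length us}. cinner (xs ! i) ((us @ y # vs) ! i)) =
      (\<Prod>i\<in>{..<length xs} - {length us}. cinner (xs ! i) ((us @ 0 # vs) ! i))"
    by (intro prod.cong) (auto simp: nth_append nth_Cons')
  finally show ?thesis using True by (simp add: tensor_inner_def)
qed (simp add: tensor_inner_def)

lemma tensor_inner_commute: "tensor_inner xs ys = cnj (tensor_inner ys xs)"
  by (simp add: tensor_inner_def cinner_commute[of "xs ! _" "ys ! _"])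

lemma multilinear_tensor_inner: "multilinear (tensor_inner xs)"
  unfolding multilinear_def clinear_def tensor_inner_split
  by (simp add: cinner_add_right cinner_scaleC_right scaleC_complex_def algebra_simps)

lemma fock_inner_0_ex1:
  "\<exists>!B :: 'a::complex_hilbert fock \<Rightarrow> 'a fock \<Rightarrow> complex.
     sesquilinear B \<and> (\<forall>xs ys. B (tensor xs) (tensor ys) = tensor_inner xs ys)"
proof (rule ex_ex1I)
  define \<psi> where "\<psi> g xs = cnj (lin_ext (tensor_inner xs) g)" for g :: "'a fock" and xs
  note lin = clinear_lin_ext[OF multilinear_tensor_inner]
  have \<psi>_tensor: "\<psi> (tensor ys) xs = tensor_inner ys xs" for xs ys
    by (simp add: \<psi>_def lin_ext_tensor[OF multilinear_tensor_inner]
        tensor_inner_commute[of ys xs])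
  have \<psi>_add: "\<psi> (g + h) xs = \<psi> g xs + \<psi> h xs" for g h xs
    by (simp add: \<psi>_def clinear_add[OF lin])
  have \<psi>_scaleC: "\<psi> (c *\<^sub>C g) xs = cnj c * \<psi> g xs" for c g xs
    by (simp add: \<psi>_def clinear_scaleC[OF lin] scaleC_complex_def)
  have multi: "multilinear (\<psi> g)" for g
  proof (induction g rule: fock_induct)
    case zero
    then show ?case by (simp add: \<psi>_def clinear_zero[OF lin] multilinear_def clinear_def)
  next
    case (add f g)
    then show ?case by (simp add: multilinear_def clinear_def \<psi>_add scaleC_add_right)
  next
    case (scaleC c f)
    then show ?case
      by (simp add: multilinear_def clinear_def \<psi>_scaleC scaleC_complex_def algebra_simps)
  next
    case (tensor ys)
    have "\<psi> (tensor ys) = tensor_inner ys" by (simp add: \<psi>_tensor fun_eq_iff)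
    then show ?case by (simp add: multilinear_tensor_inner)
  qed
  define B where "B f g = cnj (lin_ext (\<psi> g) f)" for f g
  note lin' = clinear_lin_ext[OF multi]
  have "B f (g + h) = B f g + B f h" for f g h
  proof -
    have "lin_ext (\<psi> (g + h)) = (\<lambda>f. lin_ext (\<psi> g) f + lin_ext (\<psi> h) f)"
      by (rule clinear_fock_eqI)
        (simp_all add: lin' clinear_def clinear_add[OF lin'] clinear_scaleC[OF lin']
          scaleC_add_right lin_ext_tensor[OF multi] \<psi>_add)
    then show ?thesis by (simp add: B_def)
  qed
  moreover have "B f (c *\<^sub>C g) = c * B f g" for f g c
  proof -
    have "lin_ext (\<psi> (c *\<^sub>C g)) = (\<lambda>f. cnj c * lin_ext (\<psi> g) f)"
    proof (rule clinear_fock_eqI)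
      show "clinear (\<lambda>f. cnj c * lin_ext (\<psi> g) f)"
        by (simp add: clinear_def clinear_add[OF lin'] clinear_scaleC[OF lin']
            scaleC_complex_def algebra_simps)
    qed (simp_all add: lin' lin_ext_tensor[OF multi] \<psi>_scaleC)
    then show ?thesis by (simp add: B_def)
  qed
  moreover have "B (f + f') g = B f g + B f' g" "B (c *\<^sub>C f) g = cnj c * B f g" for c f f' g
    by (simp_all add: B_def clinear_add[OF lin'] clinear_scaleC[OF lin'] scaleC_complex_def)
  moreover have "B (tensor xs) (tensor ys) = tensor_inner xs ys" for xs ys
    by (simp add: B_def lin_ext_tensor[OF multi] \<psi>_tensor tensor_inner_commute[of xs ys])
  ultimately show "\<exists>B :: 'a fock \<Rightarrow> 'a fock \<Rightarrow> complex.
     sesquilinear B \<and> (\<forall>xs ys. B (tensor xs) (tensor ys) = tensor_inner xs ys)"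
    by (intro exI[of _ B]) (simp add: sesquilinear_def clinear_def scaleC_complex_def)
next
  fix B C :: "'a fock \<Rightarrow> 'a fock \<Rightarrow> complex"
  assume B: "sesquilinear B \<and> (\<forall>xs ys. B (tensor xs) (tensor ys) = tensor_inner xs ys)"
    and C: "sesquilinear C \<and> (\<forall>xs ys. C (tensor xs) (tensor ys) = tensor_inner xs ys)"
  have zero_left: "D 0 g = 0" if "sesquilinear D" for D :: "'a fock \<Rightarrow> 'a fock \<Rightarrow> complex" and g
  proof -
    have "D (0 *\<^sub>C 0) g = cnj 0 * D 0 g" using that unfolding sesquilinear_def by blast
    then show ?thesis by simp
  qed
  have "B f = C f" for f
  proof (induction f rule: fock_induct)
    case (tensor xs)
    show ?case by (rule clinear_fock_eqI) (use B C in \<open>auto simp: sesquilinear_def\<close>)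
  next
    case zero
    show ?case using B C zero_left[of B] zero_left[of C] by (simp add: fun_eq_iff)
  qed (use B C in \<open>auto simp: sesquilinear_def fun_eq_iff\<close>)
  then show "B = C" by blast
qed

lemma sesquilinear_fock_inner_0: "sesquilinear fock_inner_0"
  and fock_inner_0_tensor: "fock_inner_0 (tensor xs) (tensor ys) = tensor_inner xs ys"
  using theI'[OF fock_inner_0_ex1] unfolding fock_inner_0_def by auto


section \<open>The Coxeter groups of type D\<close>

definition signed_perms :: "nat \<Rightarrow> (int \<Rightarrow> int) set" where
  "signed_perms n = {\<sigma>. \<sigma> permutes {k. 1 \<le> \<bar>k\<bar> \<and> \<bar>k\<bar> \<le> int n} \<and> (\<forall>k. \<sigma> (- k) = - \<sigma> k)}"

definition B_group :: "nat \<Rightarrow> (int \<Rightarrow> int) monoid" where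
  "B_group n = \<lparr>carrier = signed_perms n, monoid.mult = (\<circ>), one = id\<rparr>"

definition s_pi :: "nat \<Rightarrow> int \<Rightarrow> int" where
  "s_pi i = transpose (int i) (int i + 1) \<circ> transpose (- int i) (- int i - 1)"

definition s_bar :: "nat \<Rightarrow> int \<Rightarrow> int" where
  "s_bar n = transpose (int n) (- int n)"

text \<open>\<open>s_hat n\<close> is the generator with index \<open>n - 1\<close>.\<close>

definition s_hat :: "nat \<Rightarrow> int \<Rightarrow> int" where
  "s_hat n = s_bar n \<circ> s_pi (n - 1) \<circ> s_bar n"

definition D_gens :: "nat \<Rightarrow> (int \<Rightarrow> int) set" where
  "D_gens n = (if n < 2 then {} else insert (s_hat n) (s_pi ` {1..n - 1}))"

definition D_group :: "nat \<Rightarrow> (int \<Rightarrow> int) set" where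
  "D_group n = generate (B_group n) (D_gens n)"

definition D_length :: "nat \<Rightarrow> (int \<Rightarrow> int) \<Rightarrow> nat" where
  "D_length n \<sigma> =
     (LEAST k. \<exists>gs. length gs = k \<and> set gs \<subseteq> D_gens n \<and> foldr (\<circ>) gs id = \<sigma>)"

lemma group_B_group: "group (B_group n)"
proof (rule groupI)
  fix \<sigma> assume \<sigma>: "\<sigma> \<in> carrier (B_group n)"
  then have p: "\<sigma> permutes {k. 1 \<le> \<bar>k\<bar> \<and> \<bar>k\<bar> \<le> int n}" and neg: "\<sigma> (- k) = - \<sigma> k" for k
    by (auto simp: B_group_def signed_perms_def)
  have "inv_into UNIV \<sigma> (- k) = - inv_into UNIV \<sigma> k" for k
    using p neg by (metis permutes_inverses(1) permutes_inverses(2))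
  then have "inv_into UNIV \<sigma> \<in> carrier (B_group n)"
    using permutes_inv[OF p] by (simp add: B_group_def signed_perms_def)
  moreover have "inv_into UNIV \<sigma> \<otimes>\<^bsub>B_group n\<^esub> \<sigma> = \<one>\<^bsub>B_group n\<^esub>"
    using permutes_inv_o[OF p] by (simp add: B_group_def)
  ultimately show "\<exists>\<tau>\<in>carrier (B_group n). \<tau> \<otimes>\<^bsub>B_group n\<^esub> \<sigma> = \<one>\<^bsub>B_group n\<^esub>" by blast
qed (auto simp: B_group_def signed_perms_def o_assoc permutes_id intro: permutes_compose)

lemma s_pi_apply:
  assumes "1 \<le> i"
  shows "s_pi i k = (if k = int i then int i + 1 else if k = int i + 1 then int i
     else if k = - int i then - int i - 1 else if k = - int i - 1 then - int i else k)"
  using assms by (auto simp: s_pi_def transpose_def)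

lemma s_hat_apply:
  assumes "2 \<le> n"
  shows "s_hat n k = (if k = int n then - int n + 1 else if k = int n - 1 then - int n
     else if k = - int n then int n - 1 else if k = - int n + 1 then int n else k)"
  using assms by (auto simp: s_hat_def s_bar_def s_pi_apply transpose_def of_nat_diff)

lemma D_gens_invol: "\<sigma> \<in> D_gens n \<Longrightarrow> \<sigma> (\<sigma> k) = k"
  by (auto simp: D_gens_def s_pi_apply s_hat_apply split: if_splits)

lemma D_gens_signed: "D_gens n \<subseteq> signed_perms n"
proof
  fix \<sigma> assume \<sigma>: "\<sigma> \<in> D_gens n"
  have "bij \<sigma>" using D_gens_invol[OF \<sigma>] by (intro o_bij[of \<sigma>]) (auto simp: fun_eq_iff)
  moreover have "\<sigma> k = k" if "k \<notin> {k. 1 \<le> \<bar>k\<bar> \<and> \<bar>k\<bar> \<le> int n}" for k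
    using \<sigma> that by (auto simp: D_gens_def s_pi_apply s_hat_apply split: if_splits)
  moreover have "\<sigma> (- k) = - \<sigma> k" for k
    using \<sigma> by (auto simp: D_gens_def s_pi_apply s_hat_apply split: if_splits)
  ultimately show "\<sigma> \<in> signed_perms n"
    by (auto simp: signed_perms_def permutes_def bij_iff)
qed

lemma D_group_signed: "D_group n \<subseteq> signed_perms n"
  using group.generate_incl[OF group_B_group, of "D_gens n" n] D_gens_signed
  by (simp add: D_group_def B_group_def)

lemma finite_D_group: "finite (D_group n)"
proof (rule finite_subset)
  have "finite {k. 1 \<le> \<bar>k\<bar> \<and> \<bar>k\<bar> \<le> int n}"
    by (rule finite_subset[of _ "{- int n..int n}"]) auto
  then show "finite {\<sigma>. \<sigma> permutes {k. 1 \<le> \<bar>k\<bar> \<and> \<bar>k\<bar> \<le> int n}}"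
    by (rule finite_permutations)
  show "D_group n \<subseteq> {\<sigma>. \<sigma> permutes {k. 1 \<le> \<bar>k\<bar> \<and> \<bar>k\<bar> \<le> int n}}"
    using D_group_signed by (auto simp: signed_perms_def)
qed

lemma D_group_words: "D_group n = {foldr (\<circ>) gs id | gs. set gs \<subseteq> D_gens n}"
proof (intro subset_antisym subsetI)
  fix \<sigma> assume "\<sigma> \<in> D_group n"
  then show "\<sigma> \<in> {foldr (\<circ>) gs id | gs. set gs \<subseteq> D_gens n}"
    unfolding D_group_def
  proof induction
    case one
    then show ?case by (auto simp: B_group_def intro: exI[of _ "[]"])
  next
    case (incl h)
    then show ?case by (auto intro: exI[of _ "[h]"])
  next
    case (inv h)
    have "inv\<^bsub>B_group n\<^esub> h = h"
      using group.inv_equality[OF group_B_group[of n], of h h] D_gens_signed inv D_gens_invol[OF inv]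
      by (auto simp: B_group_def fun_eq_iff)
    with inv show ?case by (auto intro: exI[of _ "[h]"])
  next
    case (eng g h)
    then obtain gs hs where gh: "g = foldr (\<circ>) gs id" "h = foldr (\<circ>) hs id"
      "set gs \<subseteq> D_gens n" "set hs \<subseteq> D_gens n" by blast
    have "foldr (\<circ>) (gs @ hs) id = foldr (\<circ>) gs id \<circ> foldr (\<circ>) hs id"
      by (induction gs) (simp_all add: o_assoc)
    then have "g \<otimes>\<^bsub>B_group n\<^esub> h = foldr (\<circ>) (gs @ hs) id"
      by (simp only: gh B_group_def monoid.simps)
    moreover have "set (gs @ hs) \<subseteq> D_gens n" using gh by simp
    ultimately show ?case by blast
  qed
next
  fix \<sigma> assume "\<sigma> \<in> {foldr (\<circ>) gs id | gs. set gs \<subseteq> D_gens n}"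
  then obtain gs where "\<sigma> = foldr (\<circ>) gs id" "set gs \<subseteq> D_gens n" by blast
  moreover have "set gs \<subseteq> D_gens n \<Longrightarrow> foldr (\<circ>) gs id \<in> generate (B_group n) (D_gens n)"
  proof (induction gs)
    case Nil
    have "id \<in> generate (B_group n) (D_gens n)"
      using generate.one[of "B_group n" "D_gens n"] unfolding B_group_def by (simp only: monoid.simps)
    then show ?case by (simp add: id_def)
  next
    case (Cons g gs)
    then have "g \<in> generate (B_group n) (D_gens n)"
      and "foldr (\<circ>) gs id \<in> generate (B_group n) (D_gens n)"
      by (simp_all only: list.set insert_subset generate.incl)
    then have "g \<otimes>\<^bsub>B_group n\<^esub> foldr (\<circ>) gs id \<in> generate (B_group n) (D_gens n)"
      by (rule generate.eng)
    moreover have "g \<otimes>\<^bsub>B_group n\<^esub> foldr (\<circ>) gs id = foldr (\<circ>) (g # gs) id"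
      by (simp only: B_group_def monoid.simps foldr.simps comp_apply)
    ultimately show ?case by (simp only:)
  qed
  ultimately show "\<sigma> \<in> D_group n" by (simp add: D_group_def)
qed


section \<open>The q-deformed Fock space of type D\<close>

text \<open>With \<open>x\<^sub>-\<^sub>k = J x\<^sub>k\<close>, a signed permutation \<open>\<sigma>\<close> sends \<open>x\<^sub>1 \<otimes> \<dots> \<otimes> x\<^sub>n\<close> to the elementary tensor
  whose \<open>i\<close>-th factor is \<open>x\<^sub>j\<close> with \<open>j = \<sigma>\<inverse> i\<close>. The lemmas \<open>act_id\<close>, \<open>act_comp\<close>, \<open>act_s_pi\<close> and
  \<open>act_s_hat\<close> show that this is the action with the prescribed values on the generators.\<close>

definition signed_nth :: "('a \<Rightarrow> 'a) \<Rightarrow> 'a list \<Rightarrow> int \<Rightarrow> 'a" where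
  "signed_nth J xs k = (if k > 0 then xs ! (nat k - 1) else J (xs ! (nat (- k) - 1)))"

definition act :: "('a \<Rightarrow> 'a) \<Rightarrow> (int \<Rightarrow> int) \<Rightarrow> 'a list \<Rightarrow> 'a list" where
  "act J \<sigma> xs = map (\<lambda>i. signed_nth J xs (inv_into UNIV \<sigma> (int i))) [1..<Suc (length xs)]"

text \<open>The operator on the whole Fock space; its restriction to the \<open>n\<close>-th tensor power is the sum
  over \<open>D(n)\<close>.\<close>

definition P_hat :: "('a::complex_hilbert \<Rightarrow> 'a) \<Rightarrow> real \<Rightarrow> 'a fock \<Rightarrow> 'a fock" where
  "P_hat J q = lin_ext (\<lambda>xs. \<Sum>\<sigma>\<in>D_group (length xs).
     complex_of_real (q ^ D_length (length xs) \<sigma>) *\<^sub>C tensor (act J \<sigma> xs))"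

definition fock_inner :: "('a::complex_hilbert \<Rightarrow> 'a) \<Rightarrow> real \<Rightarrow> 'a fock \<Rightarrow> 'a fock \<Rightarrow> complex" where
  "fock_inner J q f g = fock_inner_0 f (P_hat J q g)"

definition creation :: "'a::complex_vector \<Rightarrow> 'a fock \<Rightarrow> 'a fock" where
  "creation x = lin_ext (\<lambda>xs. tensor (x # xs))"

text \<open>The adjoint is unique for \<open>-1 < q < 1\<close>, because \<open>fock_inner J q\<close> is then positive definite.\<close>

definition annihilation :: "('a::complex_hilbert \<Rightarrow> 'a) \<Rightarrow> real \<Rightarrow> 'a \<Rightarrow> 'a fock \<Rightarrow> 'a fock" where
  "annihilation J q x = (SOME A. clinear A \<and>
     (\<forall>f g. fock_inner J q (A f) g = fock_inner J q f (creation x g)))"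

definition gaussian :: "('a::complex_hilbert \<Rightarrow> 'a) \<Rightarrow> real \<Rightarrow> 'a \<Rightarrow> 'a fock \<Rightarrow> 'a fock" where
  "gaussian J q x f = annihilation J q x f + creation x f"

lemma length_act [simp]: "length (act J \<sigma> xs) = length xs"
  by (simp add: act_def del: upt_Suc)

lemma nth_act:
  "i < length xs \<Longrightarrow> act J \<sigma> xs ! i = signed_nth J xs (inv_into UNIV \<sigma> (int i + 1))"
  by (simp add: act_def nth_map_upt add.commute del: upt_Suc)

lemma inv_signed_perms:
  assumes "\<sigma> \<in> signed_perms n"
  shows "inv_into UNIV \<sigma> \<in> signed_perms n"
proof -
  have p: "\<sigma> permutes {k. 1 \<le> \<bar>k\<bar> \<and> \<bar>k\<bar> \<le> int n}" and neg: "\<sigma> (- k) = - \<sigma> k" for k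
    using assms by (auto simp: signed_perms_def)
  have "inv_into UNIV \<sigma> (- k) = - inv_into UNIV \<sigma> k" for k
    using p neg by (metis permutes_inverses(1) permutes_inverses(2))
  then show ?thesis using permutes_inv[OF p] by (simp add: signed_perms_def)
qed

lemma signed_perms_range:
  assumes "\<sigma> \<in> signed_perms n" "1 \<le> \<bar>k\<bar>" "\<bar>k\<bar> \<le> int n"
  shows "1 \<le> \<bar>\<sigma> k\<bar>" "\<bar>\<sigma> k\<bar> \<le> int n"
  using assms permutes_in_image[of \<sigma> "{k. 1 \<le> \<bar>k\<bar> \<and> \<bar>k\<bar> \<le> int n}" k]
  by (auto simp: signed_perms_def)

lemma act_id: "act J id xs = xs"
  by (rule nth_equalityI) (simp_all add: nth_act signed_nth_def nat_add_distrib)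

lemma act_comp:
  assumes "\<sigma> \<in> signed_perms (length xs)" "\<tau> \<in> signed_perms (length xs)" and J: "\<And>x. J (J x) = x"
  shows "act J (\<sigma> \<circ> \<tau>) xs = act J \<sigma> (act J \<tau> xs)"
proof (rule nth_equalityI)
  fix i assume "i < length (act J (\<sigma> \<circ> \<tau>) xs)"
  then have i: "i < length xs" by simp
  define k where "k = inv_into UNIV \<sigma> (int i + 1)"
  have "bij \<sigma>" "bij \<tau>" using assms by (auto simp: signed_perms_def permutes_bij)
  then have comp: "inv_into UNIV (\<sigma> \<circ> \<tau>) (int i + 1) = inv_into UNIV \<tau> k"
    by (simp add: o_inv_distrib k_def)
  have k: "1 \<le> \<bar>k\<bar>" "\<bar>k\<bar> \<le> int (length xs)"
    using signed_perms_range[OF inv_signed_perms[OF assms(1)], of "int i + 1"] i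
    by (auto simp: k_def)
  define l where "l = inv_into UNIV \<tau> \<bar>k\<bar>"
  have l: "l \<noteq> 0"
    using signed_perms_range[OF inv_signed_perms[OF assms(2)], of "\<bar>k\<bar>"] k by (auto simp: l_def)
  have neg: "inv_into UNIV \<tau> (- j) = - inv_into UNIV \<tau> j" for j
    using inv_signed_perms[OF assms(2)] by (simp add: signed_perms_def)
  have nth: "act J \<tau> xs ! (nat \<bar>k\<bar> - 1) = signed_nth J xs l"
  proof -
    have "nat \<bar>k\<bar> - 1 < length xs" "int (nat \<bar>k\<bar> - 1) + 1 = \<bar>k\<bar>" using k by linarith+
    then show ?thesis by (simp only: nth_act l_def)
  qed
  have lhs: "act J (\<sigma> \<circ> \<tau>) xs ! i = signed_nth J xs (inv_into UNIV \<tau> k)"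
    using i by (simp only: nth_act comp)
  have rhs: "act J \<sigma> (act J \<tau> xs) ! i = signed_nth J (act J \<tau> xs) k"
    using i by (simp only: nth_act length_act k_def)
  show "act J (\<sigma> \<circ> \<tau>) xs ! i = act J \<sigma> (act J \<tau> xs) ! i"
  proof (cases "k > 0")
    case True
    then have "signed_nth J (act J \<tau> xs) k = act J \<tau> xs ! (nat \<bar>k\<bar> - 1)"
      by (simp add: signed_nth_def[of J "act J \<tau> xs"])
    moreover have "inv_into UNIV \<tau> k = l" using True by (simp add: l_def)
    ultimately show ?thesis by (simp only: lhs rhs nth)
  next
    case False
    then have "signed_nth J (act J \<tau> xs) k = J (act J \<tau> xs ! (nat \<bar>k\<bar> - 1))"
      by (simp add: signed_nth_def[of J "act J \<tau> xs"])
    moreover have "inv_into UNIV \<tau> k = - l" using False neg[of k] by (simp add: l_def)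
    moreover have "signed_nth J xs (- l) = J (signed_nth J xs l)"
      using l J by (auto simp: signed_nth_def)
    ultimately show ?thesis by (simp only: lhs rhs nth)
  qed
qed simp

lemma inv_invol: "(\<And>k. \<sigma> (\<sigma> k) = k) \<Longrightarrow> inv_into UNIV \<sigma> = \<sigma>"
  by (rule inv_equality) auto

lemma act_s_pi:
  assumes "i = Suc (length us)"
  shows "act J (s_pi i) (us @ x # y # vs) = us @ y # x # vs"
proof -
  have inv: "inv_into UNIV (s_pi i) = s_pi i"
    using assms by (intro inv_invol) (auto simp: s_pi_apply)
  show ?thesis
  proof (intro nth_equalityI)
    fix j assume "j < length (act J (s_pi i) (us @ x # y # vs))"
    then have j: "j < length (us @ x # y # vs)" by simp
    have "j < length us \<or> j = length us \<or> j = Suc (length us) \<or> (\<exists>k. j = length us + Suc (Suc k))"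
      by presburger
    then consider "j < length us" | "j = length us" | "j = Suc (length us)"
      | k where "j = length us + Suc (Suc k)" by blast
    then show "act J (s_pi i) (us @ x # y # vs) ! j = (us @ y # x # vs) ! j"
      using j assms inv
      by cases (simp_all add: nth_act s_pi_apply signed_nth_def nth_append nat_add_distrib)
  qed simp
qed

lemma act_s_hat:
  assumes "n = length us + 2"
  shows "act J (s_hat n) (us @ [x, y]) = us @ [J y, J x]"
proof -
  have inv: "inv_into UNIV (s_hat n) = s_hat n"
    using assms by (intro inv_invol) (auto simp: s_hat_apply)
  show ?thesis
  proof (intro nth_equalityI)
    fix j assume "j < length (act J (s_hat n) (us @ [x, y]))"
    then have j: "j < length (us @ [x, y])" by simp
    then consider "j < length us" | "j = length us" | "j = Suc (length us)"
      by fastforce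
    then show "act J (s_hat n) (us @ [x, y]) ! j = (us @ [J y, J x]) ! j"
      using j assms inv
      by cases (simp_all add: nth_act s_hat_apply signed_nth_def nth_append nat_add_distrib)
  qed simp
qed

lemma multilinear_creation: "multilinear (\<lambda>xs. tensor (x # xs))"
  unfolding multilinear_def
proof (intro allI)
  fix us vs
  show "clinear (\<lambda>y. tensor (x # us @ y # vs))"
    using multilinear_tensor[unfolded multilinear_def, rule_format, of "x # us" vs] by simp
qed

lemma creation_tensor: "creation x (tensor xs) = tensor (x # xs)"
  by (simp add: creation_def lin_ext_tensor[OF multilinear_creation])

lemma clinear_tensor_act:
  assumes J: "clinear J" and \<sigma>: "\<sigma> \<in> signed_perms (length us + Suc (length vs))"
  shows "clinear (\<lambda>x. tensor (act J \<sigma> (us @ x # vs)))"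
proof -
  let ?n = "length us + Suc (length vs)" and ?\<tau> = "inv_into UNIV \<sigma>"
  define k where "k = int (length us) + 1"
  define p where "p = nat \<bar>\<sigma> k\<bar> - 1"
  have \<tau>: "?\<tau> \<in> signed_perms ?n" by (rule inv_signed_perms[OF \<sigma>])
  have perm: "\<sigma> permutes {k. 1 \<le> \<bar>k\<bar> \<and> \<bar>k\<bar> \<le> int ?n}"
    and neg\<sigma>: "\<sigma> (- j) = - \<sigma> j" and neg: "?\<tau> (- j) = - ?\<tau> j" for j
    using \<sigma> \<tau> by (auto simp: signed_perms_def)
  note inverses = permutes_inverses[OF perm]
  have \<sigma>k: "1 \<le> \<bar>\<sigma> k\<bar>" "\<bar>\<sigma> k\<bar> \<le> int ?n"
    using signed_perms_range[OF \<sigma>, of k] by (auto simp: k_def)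
  then have p: "p < ?n" "int p + 1 = \<bar>\<sigma> k\<bar>" by (auto simp: p_def)
  have \<tau>p: "\<bar>?\<tau> (int p + 1)\<bar> = k"
    using p(2) inverses neg by (cases "\<sigma> k \<ge> 0") (auto simp: k_def)
  define L where "L x = act J \<sigma> (us @ x # vs)" for x
  define e where "e x = (if ?\<tau> (int p + 1) > 0 then x else J x)" for x
  have other: "L x ! i = L 0 ! i" if "i < ?n" "i \<noteq> p" for i x
  proof -
    let ?j = "?\<tau> (int i + 1)"
    have j: "1 \<le> \<bar>?j\<bar>" using signed_perms_range[OF \<tau>, of "int i + 1"] that by auto
    have "\<bar>?j\<bar> \<noteq> k"
    proof
      assume "\<bar>?j\<bar> = k"
      then have "\<sigma> k = int i + 1 \<or> \<sigma> k = - (int i + 1)"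
        using inverses(1)[of "int i + 1"] neg\<sigma>[of ?j] by (cases "?j \<ge> 0") auto
      then show False using p(2) that by auto
    qed
    then show ?thesis
      using that j by (auto simp: L_def nth_act signed_nth_def nth_append nth_Cons' k_def)
  qed
  have here: "L x ! p = e x" for x
    using \<tau>p p by (auto simp: L_def nth_act signed_nth_def e_def nth_append nth_Cons' k_def)
  have L: "L x = take p (L 0) @ e x # drop (Suc p) (L 0)" for x
  proof (rule nth_equalityI)
    show "length (L x) = length (take p (L 0) @ e x # drop (Suc p) (L 0))"
      using p by (simp add: L_def)
    fix i assume "i < length (L x)"
    then have "i < ?n" by (simp add: L_def)
    moreover have "length (L 0) = ?n" by (simp add: L_def)
    ultimately show "L x ! i = (take p (L 0) @ e x # drop (Suc p) (L 0)) ! i"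
      using p(1) other[of i x] here[of x] by (cases i p rule: linorder_cases)
        (auto simp: nth_append nth_Cons' min_def)
  qed
  have "clinear (\<lambda>x. tensor (take p (L 0) @ e x # drop (Suc p) (L 0)))"
    using multilinear_tensor J by (auto simp: multilinear_def clinear_def e_def)
  then show ?thesis by (simp flip: L add: L_def[symmetric])
qed

lemma P_hat_tensor:
  assumes "clinear J"
  shows "P_hat J q (tensor xs) = (\<Sum>\<sigma>\<in>D_group (length xs).
     complex_of_real (q ^ D_length (length xs) \<sigma>) *\<^sub>C tensor (act J \<sigma> xs))"
  and "clinear (P_hat J q)"
proof -
  have "multilinear (\<lambda>xs. \<Sum>\<sigma>\<in>D_group (length xs).
     complex_of_real (q ^ D_length (length xs) \<sigma>) *\<^sub>C tensor (act J \<sigma> xs))"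
    unfolding multilinear_def
  proof (intro allI)
    fix us vs :: "'a list"
    let ?n = "length us + Suc (length vs)"
    have "clinear (\<lambda>x. \<Sum>\<sigma>\<in>D_group ?n. c \<sigma> *\<^sub>C tensor (act J \<sigma> (us @ x # vs)))"
      for c :: "(int \<Rightarrow> int) \<Rightarrow> complex"
    proof (rule clinear_sum_scaleC)
      fix \<sigma> assume "\<sigma> \<in> D_group ?n"
      then have "\<sigma> \<in> signed_perms ?n" using D_group_signed by blast
      then show "clinear (\<lambda>x. tensor (act J \<sigma> (us @ x # vs)))"
        by (rule clinear_tensor_act[OF assms])
    qed
    then show "clinear (\<lambda>x. \<Sum>\<sigma>\<in>D_group (length (us @ x # vs)).
        complex_of_real (q ^ D_length (length (us @ x # vs)) \<sigma>) *\<^sub>C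
          tensor (act J \<sigma> (us @ x # vs)))"
      by (simp only: length_append list.size(4) add_0_right One_nat_def add_Suc_right)
  qed
  then show "P_hat J q (tensor xs) = (\<Sum>\<sigma>\<in>D_group (length xs).
     complex_of_real (q ^ D_length (length xs) \<sigma>) *\<^sub>C tensor (act J \<sigma> xs))"
    and "clinear (P_hat J q)"
    unfolding P_hat_def by (rule lin_ext_tensor, rule clinear_lin_ext)
qed


section \<open>Pair partitions\<close>

definition pair_partitions :: "nat \<Rightarrow> nat set set set" where
  "pair_partitions n = {\<pi>. partition_on {1..n} \<pi> \<and> (\<forall>b\<in>\<pi>. card b = 2)}"

definition crossing :: "nat set \<Rightarrow> nat set \<Rightarrow> bool" where
  "crossing A B \<longleftrightarrow> (\<exists>a b c d. A = {a, b} \<and> a < b \<and> B = {c, d} \<and> c < d \<and>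
     (a < c \<and> c < b \<and> b < d \<or> c < a \<and> a < d \<and> d < b))"

text \<open>Crossing is symmetric, so its reflexive transitive closure is an equivalence relation.\<close>

definition crossing_equiv :: "nat set set \<Rightarrow> (nat set \<times> nat set) set" where
  "crossing_equiv \<pi> = {(A, B). A \<in> \<pi> \<and> B \<in> \<pi> \<and>
     (A, B) \<in> {(C, D). C \<in> \<pi> \<and> D \<in> \<pi> \<and> crossing C D}\<^sup>*}"

definition components :: "nat set set \<Rightarrow> nat set set" where
  "components \<pi> = Union ` (\<pi> // crossing_equiv \<pi>)"

definition covers :: "nat set \<Rightarrow> nat set \<Rightarrow> bool" where
  "covers A B \<longleftrightarrow> (\<exists>i\<in>A. \<exists>j\<in>A. \<forall>k\<in>B. i < k \<and> k < j)"

definition n_outer :: "nat set set \<Rightarrow> nat" where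
  "n_outer \<pi> = card {C \<in> components \<pi>. \<not> (\<exists>D\<in>components \<pi>. D \<noteq> C \<and> covers D C)}"

lemma equiv_crossing_equiv: "equiv \<pi> (crossing_equiv \<pi>)"
proof (rule equivI)
  have "sym {(C, D). C \<in> \<pi> \<and> D \<in> \<pi> \<and> crossing C D}"
    by (rule symI) (auto simp: crossing_def)
  from sym_rtrancl[OF this] show "sym (crossing_equiv \<pi>)"
    unfolding crossing_equiv_def sym_def by blast
  show "trans (crossing_equiv \<pi>)"
    unfolding crossing_equiv_def by (rule transI) auto
qed (auto simp: crossing_equiv_def refl_on_def)

text \<open>Every component contains a block, so the subtraction \<open>m - n_outer \<pi>\<close> does not truncate for
  pair partitions of \<open>2 * m\<close> points.\<close>

lemma n_outer_le:
  assumes "\<pi> \<in> pair_partitions (2 * m)"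
  shows "n_outer \<pi> \<le> m"
proof -
  have part: "partition_on {1..2 * m} \<pi>" "\<And>b. b \<in> \<pi> \<Longrightarrow> card b = 2"
    using assms by (auto simp: pair_partitions_def)
  have fin: "finite \<pi>" using part(1) by (rule finite_elements[rotated]) simp
  have finb: "finite b" if "b \<in> \<pi>" for b
    using part(2)[OF that] by (intro card_ge_0_finite) simp
  have "2 * m = (\<Sum>b\<in>\<pi>. card b)"
    using card_Union_disjoint[of \<pi>] part(1) finb
    by (auto simp: partition_on_def disjoint_def pairwise_def disjnt_def)
  then have card: "card \<pi> = m" using part(2) by simp
  have quot: "\<pi> // crossing_equiv \<pi> = (\<lambda>b. crossing_equiv \<pi> `` {b}) ` \<pi>"
    by (auto simp: quotient_def)
  have comp: "components \<pi> = (\<lambda>b. \<Union> (crossing_equiv \<pi> `` {b})) ` \<pi>"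
    by (simp add: components_def quot image_image)
  have "n_outer \<pi> \<le> card (components \<pi>)"
    unfolding n_outer_def by (rule card_mono) (auto simp: comp fin)
  also have "\<dots> \<le> card \<pi>" unfolding comp by (rule card_image_le[OF fin])
  finally show ?thesis using card by simp
qed

end

theory Submission
  imports Defs
begin

text \<open>
  The image of \<open>1\<close> under an element of \<open>D(n+1)\<close> splits the group into cosets of the copy of \<open>D(n)\<close>
  that fixes \<open>1\<close>. Each coset contains a unique element of least length, and lengths add along the
  decomposition (\<open>D_group_Suc_bij\<close>, \<open>D_length_coset_factor\<close>). Hence \<open>P_hat\<close> on \<open>x \<otimes> f\<close> is
  a sum over coset representatives applied to \<open>x \<otimes> P_hat f\<close>, and moving the representatives to the
  other side of the inner product gives an explicit adjoint of the creation operator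
  (\<open>coset_annihilation_adjoint\<close>): it contracts \<open>x\<close> with each factor \<open>k\<close> of
  \<open>x\<^sub>1 \<otimes> \<dots> \<otimes> x\<^sub>n\<close>, once with the weight \<open>q ^ (k - 1)\<close> and, if \<open>n \<ge> 2\<close>, a second time with the weight \<open>q ^ (2 * n - 1 - k)\<close>, where the
  involution is applied to the contracted factor and to the last one of the remaining factors.

  Two adjoints of the creation operator differ by an operator into the null space of the form. The
  form is Hermitian, so the Gaussian operators preserve its null space, and the moments can be
  computed with the explicit adjoint for every real \<open>q\<close> (\<open>moment_Suc_coset\<close>). On vectors fixed by
  the involution this yields the recursion \<open>wick\<close>, whose values are polynomials in \<open>q\<close>; the limit is
  the value at \<open>q = 1\<close>. There an annihilation has the weight \<open>2\<close>, except that it has the weight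
  \<open>1\<close> when only one tensor factor is left, because \<open>D(1)\<close> is trivial.

  Unfolding the recursion produces a sum over pair partitions. The pair with the smaller point \<open>k\<close> is
  formed when the operator with index \<open>k\<close> annihilates; the tensor factors present at that moment
  belong to the pairs \<open>a < b\<close> with \<open>a \<le> k < b\<close>. So a pair has the weight \<open>1\<close> exactly if its minimum
  lies strictly inside no other pair (\<open>wick_eq_sum_pairings\<close>). These pairs are the ones that contain
  the minimum of an outer component (\<open>n_outer_eq_card_uncovered\<close>), which leaves the factor
  \<open>2 ^ (m - n_outer \<pi>)\<close>.
\<close>

section \<open>Coset representatives of type D\<close>

text \<open>The embedding of \<open>D(n)\<close> into \<open>D(n+1)\<close> as a group that fixes \<open>1\<close>: conjugation by the odd
  injection \<open>v \<mapsto> v + sgn v\<close>, which carries the points \<open>\<plusminus>1, \<dots>, \<plusminus>n\<close> to \<open>\<plusminus>2, \<dots>, \<plusminus>(n+1)\<close>.\<close>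

definition shift :: "(int \<Rightarrow> int) \<Rightarrow> int \<Rightarrow> int" where
  "shift w k = (if \<bar>k\<bar> \<le> 1 then k else (let v = w (k - sgn k) in v + sgn v))"

text \<open>The possible images of \<open>1\<close> under \<open>D(n)\<close>. The exception is \<open>D(1)\<close>, which is trivial; it is the
  source of the weight \<open>1\<close> for outer components.\<close>

definition coset_index :: "nat \<Rightarrow> int set" where
  "coset_index n = {a. 1 \<le> \<bar>a\<bar> \<and> \<bar>a\<bar> \<le> int n \<and> (n = 1 \<longrightarrow> a = 1)}"

text \<open>For \<open>1 \<le> b\<close> this is the odd extension of the cycle that moves \<open>1\<close> to \<open>b\<close> and lowers
  \<open>2, \<dots>, b\<close> by one.\<close>

definition cycle_to :: "int \<Rightarrow> int \<Rightarrow> int" where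
  "cycle_to b k = (if k = 1 then b else if k = -1 then -b
     else if 2 \<le> k \<and> k \<le> b then k - 1 else if -b \<le> k \<and> k \<le> -2 then k + 1 else k)"

definition flip_ends :: "nat \<Rightarrow> int \<Rightarrow> int" where
  "flip_ends n k = (if \<bar>k\<bar> = 1 \<or> \<bar>k\<bar> = int n then - k else k)"

text \<open>The shortest element of \<open>D(n)\<close> that maps \<open>1\<close> to \<open>a\<close>. Elements of \<open>D(n)\<close> change an even number
  of signs, so for negative \<open>a\<close> the sign at the last point is changed together with the sign at \<open>1\<close>.\<close>

definition coset_rep :: "nat \<Rightarrow> int \<Rightarrow> int \<Rightarrow> int" where
  "coset_rep n a = (if a < 0 then cycle_to (- a) \<circ> flip_ends n else cycle_to a)"

text \<open>The distance from \<open>1\<close> to \<open>a\<close> when every generator joins each point to its image. For \<open>n \<ge> 2\<close>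
  the points \<open>n\<close> and \<open>-n\<close> are both reached from \<open>n - 1\<close> in one step, and \<open>-1\<close> is the farthest
  point.\<close>

definition coset_length :: "nat \<Rightarrow> int \<Rightarrow> nat" where
  "coset_length n a = (if a > 0 then nat a - 1 else 2 * n - 1 - nat (- a))"

lemma shift_comp:
  assumes "w \<in> signed_perms n"
  shows "shift (v \<circ> w) = shift v \<circ> shift w"
proof
  fix k :: int
  show "shift (v \<circ> w) k = (shift v \<circ> shift w) k"
  proof (cases "\<bar>k\<bar> \<le> 1")
    case False
    have inj: "inj w" using assms by (auto simp: signed_perms_def intro: permutes_inj)
    have w0: "w 0 = 0" using assms by (auto simp: signed_perms_def permutes_def)
    have "k - sgn k \<noteq> 0" using False by (auto simp: sgn_if)
    \<comment> \<open>The map \<open>v \<mapsto> v + sgn v\<close> can only be undone away from \<open>0\<close>.\<close>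
    then have nz: "w (k - sgn k) \<noteq> 0" using inj w0 by (metis injD)
    then show ?thesis using False
      by (auto simp: shift_def Let_def sgn_if)
  qed (auto simp: shift_def)
qed

lemma shift_id: "shift id = id"
  by (auto simp: shift_def fun_eq_iff sgn_if)

lemma shift_s_pi: "1 \<le> i \<Longrightarrow> shift (s_pi i) = s_pi (Suc i)"
  by (auto simp: fun_eq_iff shift_def s_pi_apply sgn_if Let_def)

lemma shift_s_hat: "2 \<le> n \<Longrightarrow> shift (s_hat n) = s_hat (Suc n)"
  by (auto simp: fun_eq_iff shift_def s_hat_apply sgn_if Let_def)

lemma shift_D_gens: "g \<in> D_gens n \<Longrightarrow> shift g \<in> D_gens (Suc n)"
  by (auto simp: D_gens_def shift_s_pi shift_s_hat split: if_splits)

text \<open>Restricting identities of signed permutations to positive arguments removes half of the cases of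
  the defining formulas.\<close>

lemma odd_fun_eqI:
  fixes f g :: "int \<Rightarrow> int"
  assumes "\<And>k. f (- k) = - f k" "\<And>k. g (- k) = - g k" "\<And>k. k > 0 \<Longrightarrow> f k = g k"
  shows "f = g"
proof
  fix k
  have "f 0 = 0" "g 0 = 0" using assms(1,2)[of 0] by auto
  then show "f k = g k"
    using assms(1,2)[of "- k"] assms(3)[of k] assms(3)[of "- k"]
    by (cases k "0 :: int" rule: linorder_cases) auto
qed

lemma s_pi_odd: "1 \<le> i \<Longrightarrow> s_pi i (- k) = - s_pi i k"
  by (auto simp: s_pi_apply)

lemma s_hat_odd: "2 \<le> n \<Longrightarrow> s_hat n (- k) = - s_hat n k"
  by (auto simp: s_hat_apply)

lemma cycle_to_odd: "cycle_to b (- k) = - cycle_to b k"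
  by (auto simp: cycle_to_def)

lemma flip_ends_odd: "flip_ends n (- k) = - flip_ends n k"
  by (simp add: flip_ends_def)

lemmas odd_simps = s_pi_odd s_hat_odd cycle_to_odd flip_ends_odd

lemma s_pi_pos: "1 \<le> i \<Longrightarrow> k > 0 \<Longrightarrow>
    s_pi i k = (if k = int i then int i + 1 else if k = int i + 1 then int i else k)"
  by (simp add: s_pi_apply)

lemma s_hat_pos: "2 \<le> n \<Longrightarrow> k > 0 \<Longrightarrow>
    s_hat n k = (if k = int n then - (int n - 1) else if k = int n - 1 then - int n else k)"
  by (simp add: s_hat_apply)

lemma cycle_to_pos: "k > 0 \<Longrightarrow> cycle_to b k = (if k = 1 then b else if k \<le> b then k - 1 else k)"
  by (simp add: cycle_to_def)

lemma flip_ends_pos: "k > 0 \<Longrightarrow> flip_ends n k = (if k = 1 \<or> k = int n then - k else k)"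
  by (simp add: flip_ends_def)

lemmas pos_simps = s_pi_pos s_hat_pos cycle_to_pos flip_ends_pos

lemma flip_ends_flip_ends: "flip_ends n \<circ> flip_ends n = id"
  by (auto simp: fun_eq_iff flip_ends_def)

lemma s_pi_cycle_to_up:
  assumes "1 \<le> i"
  shows "s_pi i \<circ> cycle_to (int i) = cycle_to (int i + 1)"
  using assms by (intro odd_fun_eqI) (auto simp: odd_simps pos_simps)

lemma s_pi_cycle_to_down:
  assumes "1 \<le> i"
  shows "s_pi i \<circ> cycle_to (int i + 1) = cycle_to (int i)"
  using assms by (intro odd_fun_eqI) (auto simp: odd_simps pos_simps)

lemma s_hat_cycle_to_last:
  assumes "2 \<le> n"
  shows "s_hat n \<circ> cycle_to (int n) = cycle_to (int n - 1) \<circ> flip_ends n"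
  using assms by (intro odd_fun_eqI) (auto simp: odd_simps pos_simps)

lemma s_hat_cycle_to_before_last:
  assumes "2 \<le> n"
  shows "s_hat n \<circ> cycle_to (int n - 1) = cycle_to (int n) \<circ> flip_ends n"
  using assms by (intro odd_fun_eqI) (auto simp: odd_simps pos_simps)

lemma s_pi_cycle_to_commute_below:
  assumes "1 \<le> i" "int i + 1 < b"
  shows "s_pi i \<circ> cycle_to b = cycle_to b \<circ> s_pi (Suc i)"
  using assms by (intro odd_fun_eqI) (auto simp: odd_simps pos_simps)

lemma s_pi_cycle_to_commute_above:
  assumes "1 \<le> b" "b < int i"
  shows "s_pi i \<circ> cycle_to b = cycle_to b \<circ> s_pi i"
  using assms by (intro odd_fun_eqI) (auto simp: odd_simps pos_simps)

lemma s_hat_cycle_to_commute: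
  assumes "2 \<le> n" "1 \<le> b" "b < int n - 1"
  shows "s_hat n \<circ> cycle_to b = cycle_to b \<circ> s_hat n"
proof (rule odd_fun_eqI)
  fix k :: int assume "k > 0"
  then show "(s_hat n \<circ> cycle_to b) k = (cycle_to b \<circ> s_hat n) k"
    using assms cycle_to_odd[of b "int n"] cycle_to_odd[of b "int n - 1"]
    by (auto simp: s_hat_pos cycle_to_pos)
qed (use assms in \<open>auto simp: odd_simps\<close>)

lemma s_pi_flip_ends:
  assumes "2 \<le> i" "i + 1 < n"
  shows "s_pi i \<circ> flip_ends n = flip_ends n \<circ> s_pi i"
  using assms by (intro odd_fun_eqI) (auto simp: odd_simps pos_simps)

lemma s_pi_flip_ends_last:
  assumes "2 \<le> i" "n = Suc i"
  shows "s_pi i \<circ> flip_ends n = flip_ends n \<circ> s_hat n"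
proof (rule odd_fun_eqI)
  fix k :: int assume "k > 0"
  then show "(s_pi i \<circ> flip_ends n) k = (flip_ends n \<circ> s_hat n) k"
    using assms flip_ends_odd[of n i] flip_ends_odd[of n n] s_pi_odd[of i n]
    by (auto simp: s_pi_odd flip_ends_odd s_pi_pos s_hat_pos flip_ends_pos)
qed (use assms in \<open>auto simp: odd_simps\<close>)

lemma s_hat_flip_ends:
  assumes "2 \<le> i" "n = Suc i"
  shows "s_hat n \<circ> flip_ends n = flip_ends n \<circ> s_pi i"
proof -
  have "flip_ends n (flip_ends n k) = k" for k
    using flip_ends_flip_ends[of n] by (simp add: fun_eq_iff)
  then show ?thesis using s_pi_flip_ends_last[OF assms] by (simp add: fun_eq_iff) metis
qed

lemma s_pi_in_D_gens: "1 \<le> i \<Longrightarrow> i < n \<Longrightarrow> s_pi i \<in> D_gens n"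
  unfolding D_gens_def by auto

lemma s_hat_in_D_gens: "2 \<le> n \<Longrightarrow> s_hat n \<in> D_gens n"
  by (simp add: D_gens_def)

text \<open>The way a generator acts on a shortest coset representative (Deodhar's lemma for this parabolic
  subgroup): it either moves to the representative of a neighbouring coset, or it passes through
  the representative and becomes a generator of the subgroup that fixes \<open>1\<close>. In the second case
  the sign change at the last point exchanges the two generators that are attached to it.\<close>

lemma coset_rep_step:
  assumes g: "g \<in> D_gens n" and a: "a \<in> coset_index n"
  obtains (move) "g a \<in> coset_index n" "g \<circ> coset_rep n a = coset_rep n (g a)"
      "coset_length n (g a) \<le> Suc (coset_length n a)"
    | (commute) h where "h \<in> D_gens (n - 1)" "g \<circ> coset_rep n a = coset_rep n a \<circ> shift h"
proof -
  have n: "2 \<le> n" using g by (auto simp: D_gens_def split: if_splits)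
  have a': "1 \<le> \<bar>a\<bar>" "\<bar>a\<bar> \<le> int n" using a by (auto simp: coset_index_def)
  have pi_gen: "s_pi (i - 1) \<in> D_gens (n - 1)" "shift (s_pi (i - 1)) = s_pi i"
    if "2 \<le> i" "i < n" for i
    using that shift_s_pi[of "i - 1"] s_pi_in_D_gens[of "i - 1" "n - 1"] by auto
  have hat_gen: "s_hat (n - 1) \<in> D_gens (n - 1)" "shift (s_hat (n - 1)) = s_hat n" if "3 \<le> n"
    using that shift_s_hat[of "n - 1"] by (auto simp: D_gens_def)
  from g n consider (pi) i where "1 \<le> i" "i < n" "g = s_pi i" | (hat) "g = s_hat n"
    by (auto simp: D_gens_def)
  then show thesis
  proof cases
    case pi
    note g = pi(3)
    consider "a = int i" | "a = int i + 1" | "a = - int i" | "a = - (int i + 1)"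
      | (below) "int i + 1 < \<bar>a\<bar>" | (above) "\<bar>a\<bar> < int i"
      using a' by linarith
    then show thesis
    proof cases
      case 1
      then show thesis using pi n
        by (intro move) (auto simp: s_pi_pos coset_index_def coset_length_def coset_rep_def
            s_pi_cycle_to_up)
    next
      case 2
      then show thesis using pi n
        by (intro move) (auto simp: s_pi_pos coset_index_def coset_length_def coset_rep_def
            s_pi_cycle_to_down)
    next
      case 3
      then have "g a = - (int i + 1)" using pi by (simp add: s_pi_odd s_pi_pos)
      moreover have "g \<circ> coset_rep n a = coset_rep n (- (int i + 1))"
        using pi 3 s_pi_cycle_to_up[of i] by (simp add: coset_rep_def add.commute flip: comp_assoc)
      ultimately show thesis using 3 pi n
        by (intro move) (auto simp: coset_index_def coset_length_def)
    next
      case 4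
      then have "g a = - int i" using pi s_pi_odd[of i "int i + 1"] by (simp add: s_pi_pos)
      moreover have "g \<circ> coset_rep n a = coset_rep n (- int i)"
        using pi 4 s_pi_cycle_to_down[of i] by (simp add: coset_rep_def add.commute flip: comp_assoc)
      ultimately show thesis using 4 pi n
        by (intro move) (auto simp: coset_index_def coset_length_def)
    next
      case below
      have cyc: "g \<circ> cycle_to \<bar>a\<bar> = cycle_to \<bar>a\<bar> \<circ> s_pi (Suc i)"
        using s_pi_cycle_to_commute_below[of i "\<bar>a\<bar>"] pi below by simp
      show thesis
      proof (cases "a < 0")
        case True
        show thesis
        proof (cases "Suc i + 1 < n")
          case True': True
          have "g \<circ> coset_rep n a = coset_rep n a \<circ> s_pi (Suc i)"
            using True cyc s_pi_flip_ends[of "Suc i" n] pi(1) True'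
            by (simp add: coset_rep_def fun_eq_iff)
          then show thesis using pi_gen[of "Suc i"] True' pi(1) by (intro commute[of "s_pi i"]) auto
        next
          case False
          then have "n = Suc (Suc i)" using below a' by linarith
          then have "g \<circ> coset_rep n a = coset_rep n a \<circ> s_hat n"
            using True cyc s_pi_flip_ends_last[of "Suc i" n] pi(1)
            by (simp add: coset_rep_def fun_eq_iff)
          then show thesis using hat_gen \<open>n = Suc (Suc i)\<close> pi(1)
            by (intro commute[of "s_hat (n - 1)"]) auto
        qed
      next
        case False
        then have "g \<circ> coset_rep n a = coset_rep n a \<circ> s_pi (Suc i)"
          using cyc by (simp add: coset_rep_def)
        moreover have "Suc i < n" using below a' by linarith
        ultimately show thesis using pi_gen[of "Suc i"] pi(1) by (intro commute[of "s_pi i"]) auto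
      qed
    next
      case above
      have cyc: "g \<circ> cycle_to \<bar>a\<bar> = cycle_to \<bar>a\<bar> \<circ> s_pi i"
        using s_pi_cycle_to_commute_above[of "\<bar>a\<bar>" i] pi above a' by simp
      have i: "2 \<le> i" using above a' by linarith
      show thesis
      proof (cases "a < 0 \<and> n = Suc i")
        case True
        then have "g \<circ> coset_rep n a = coset_rep n a \<circ> s_hat n"
          using cyc s_pi_flip_ends_last[of i n] i by (simp add: coset_rep_def fun_eq_iff)
        then show thesis using hat_gen True i by (intro commute[of "s_hat (n - 1)"]) auto
      next
        case False
        then have "g \<circ> coset_rep n a = coset_rep n a \<circ> s_pi i"
          using cyc s_pi_flip_ends[of i n] i pi(2)
          by (cases "a < 0") (simp_all add: coset_rep_def fun_eq_iff)
        then show thesis using pi_gen[OF i pi(2)] by (intro commute[of "s_pi (i - 1)"]) auto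
      qed
    qed
  next
    case hat
    consider "a = int n" | "a = int n - 1" | "a = - int n" | "a = - (int n - 1)"
      | (below) "\<bar>a\<bar> < int n - 1"
      using a' by linarith
    then show thesis
    proof cases
      case 1
      then have "g a = - (int n - 1)" using hat n by (simp add: s_hat_pos)
      moreover have "g \<circ> coset_rep n a = coset_rep n (- (int n - 1))"
        using hat 1 n s_hat_cycle_to_last[of n] by (simp add: coset_rep_def)
      ultimately show thesis using 1 n
        by (intro move) (auto simp: coset_index_def coset_length_def)
    next
      case 2
      then have "g a = - int n" using hat n by (simp add: s_hat_pos)
      moreover have "g \<circ> coset_rep n a = coset_rep n (- int n)"
        using hat 2 n s_hat_cycle_to_before_last[of n] by (simp add: coset_rep_def)
      ultimately show thesis using 2 n
        by (intro move) (auto simp: coset_index_def coset_length_def)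
    next
      case 3
      then have "g a = int n - 1" using hat n s_hat_odd[of n n] by (simp add: s_hat_pos)
      moreover have "g \<circ> coset_rep n a = coset_rep n (int n - 1)"
        using hat 3 n s_hat_cycle_to_last[of n] flip_ends_flip_ends[of n]
        by (simp add: coset_rep_def fun_eq_iff)
      ultimately show thesis using 3 n
        by (intro move) (auto simp: coset_index_def coset_length_def)
    next
      case 4
      then have "g a = int n" using hat n s_hat_odd[of n "int n - 1"] by (simp add: s_hat_pos)
      moreover have "g \<circ> coset_rep n a = coset_rep n (int n)"
        using hat 4 n s_hat_cycle_to_before_last[of n] flip_ends_flip_ends[of n]
        by (simp add: coset_rep_def fun_eq_iff)
      ultimately show thesis using 4 n
        by (intro move) (auto simp: coset_index_def coset_length_def)
    next
      case below
      have cyc: "g \<circ> cycle_to \<bar>a\<bar> = cycle_to \<bar>a\<bar> \<circ> s_hat n"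
        using s_hat_cycle_to_commute[of n "\<bar>a\<bar>"] hat below a' n by simp
      have n: "3 \<le> n" using below a' by linarith
      show thesis
      proof (cases "a < 0")
        case True
        then have "g \<circ> coset_rep n a = coset_rep n a \<circ> s_pi (n - 1)"
          using cyc s_hat_flip_ends[of "n - 1" n] n by (simp add: coset_rep_def fun_eq_iff)
        then show thesis using pi_gen[of "n - 1"] n by (intro commute[of "s_pi (n - 1 - 1)"]) auto
      next
        case False
        then have "g \<circ> coset_rep n a = coset_rep n a \<circ> s_hat n"
          using cyc by (simp add: coset_rep_def)
        then show thesis using hat_gen n by (intro commute[of "s_hat (n - 1)"]) auto
      qed
    qed
  qed
qed

lemma coset_rep_1: "coset_rep n 1 = id"
  by (auto simp: coset_rep_def cycle_to_def fun_eq_iff)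

text \<open>Every representative other than the identity is one generator away from a shorter one, which makes
  \<open>coset_length\<close> an upper bound for its word length.\<close>

lemma coset_rep_descent:
  assumes a: "a \<in> coset_index n" and len: "coset_length n a = Suc l"
  obtains g where "g \<in> D_gens n" "g a \<in> coset_index n" "coset_length n (g a) = l"
    "coset_rep n a = g \<circ> coset_rep n (g a)"
proof -
  have a': "1 \<le> \<bar>a\<bar>" "\<bar>a\<bar> \<le> int n" "n = 1 \<longrightarrow> a = 1" using a by (auto simp: coset_index_def)
  consider "a > 1" | "a = 1" | "a < 0" "\<bar>a\<bar> < int n" | "a = - int n" using a' by linarith
  then show thesis
  proof cases
    case 1
    define i where "i = nat a - 1"
    have i: "a = int i + 1" "1 \<le> i" "i < n" using 1 a' by (auto simp: i_def)
    then have "s_pi i a = int i" by (simp add: s_pi_pos)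
    then show thesis using i len s_pi_in_D_gens[of i n] s_pi_cycle_to_up[of i]
      by (intro that[of "s_pi i"]) (auto simp: coset_index_def coset_length_def coset_rep_def)
  next
    case 2
    then show thesis using len by (simp add: coset_length_def)
  next
    case 3
    define i where "i = nat (- a)"
    have i: "a = - int i" "1 \<le> i" "i < n" using 3 a' by (auto simp: i_def)
    then have ga: "s_pi i a = - (int i + 1)" by (simp add: s_pi_odd s_pi_pos)
    have "coset_rep n a = s_pi i \<circ> coset_rep n (- (int i + 1))"
      using i s_pi_cycle_to_down[of i] by (simp add: coset_rep_def add.commute flip: comp_assoc)
    then show thesis using i len s_pi_in_D_gens[of i n] ga
      by (intro that[of "s_pi i"]) (auto simp: coset_index_def coset_length_def)
  next
    case 4
    then have n: "2 \<le> n" using a' by auto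
    then have ga: "s_hat n a = int n - 1" using 4 s_hat_odd[of n n] by (simp add: s_hat_pos)
    have "coset_rep n a = s_hat n \<circ> coset_rep n (int n - 1)"
      using 4 n s_hat_cycle_to_before_last[of n] by (simp add: coset_rep_def)
    then show thesis using 4 n len s_hat_in_D_gens[of n] ga
      by (intro that[of "s_hat n"]) (auto simp: coset_index_def coset_length_def)
  qed
qed

lemma coset_rep_word:
  assumes "a \<in> coset_index n"
  shows "\<exists>gs. set gs \<subseteq> D_gens n \<and> length gs = coset_length n a \<and> foldr (\<circ>) gs id = coset_rep n a"
  using assms
proof (induction "coset_length n a" arbitrary: a)
  case 0
  then have "a = 1" by (auto simp: coset_index_def coset_length_def split: if_splits)
  then show ?case using 0 by (intro exI[of _ "[]"]) (simp add: coset_rep_1)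
next
  case (Suc l)
  then obtain g where g: "g \<in> D_gens n" "g a \<in> coset_index n" "coset_length n (g a) = l"
    "coset_rep n a = g \<circ> coset_rep n (g a)"
    using coset_rep_descent[of a n l] by metis
  then obtain gs where "set gs \<subseteq> D_gens n" "length gs = l" "foldr (\<circ>) gs id = coset_rep n (g a)"
    using Suc by metis
  then show ?case using g Suc(2) by (intro exI[of _ "g # gs"]) auto
qed

section \<open>Lengths in the coset decomposition\<close>

lemma D_length_le:
  assumes "set gs \<subseteq> D_gens n"
  shows "D_length n (foldr (\<circ>) gs id) \<le> length gs"
  unfolding D_length_def by (rule Least_le) (use assms in blast)

lemma D_length_word:
  assumes "w \<in> D_group n"
  obtains gs where "set gs \<subseteq> D_gens n" "length gs = D_length n w" "foldr (\<circ>) gs id = w"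
proof -
  from assms obtain gs where "set gs \<subseteq> D_gens n" "foldr (\<circ>) gs id = w"
    by (auto simp: D_group_words)
  then have "\<exists>gs'. length gs' = length gs \<and> set gs' \<subseteq> D_gens n \<and> foldr (\<circ>) gs' id = w" by blast
  from LeastI[of "\<lambda>k. \<exists>gs. length gs = k \<and> set gs \<subseteq> D_gens n \<and> foldr (\<circ>) gs id = w", OF this]
  show thesis using that unfolding D_length_def by blast
qed

lemma D_group_gen_comp:
  assumes "g \<in> D_gens n" "w \<in> D_group n"
  shows "g \<circ> w \<in> D_group n" "D_length n (g \<circ> w) \<le> Suc (D_length n w)"
proof -
  obtain gs where gs: "set gs \<subseteq> D_gens n" "length gs = D_length n w" "foldr (\<circ>) gs id = w"
    using D_length_word[OF assms(2)] .
  then show "D_length n (g \<circ> w) \<le> Suc (D_length n w)"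
    using D_length_le[of "g # gs" n] assms(1) by simp
  show "g \<circ> w \<in> D_group n"
    using gs assms(1) by (auto simp: D_group_words intro!: exI[of _ "g # gs"])
qed

lemma id_in_D_group: "id \<in> D_group n"
  by (auto simp: D_group_words intro!: exI[of _ "[]"])

lemma foldr_comp_Cons: "foldr (\<circ>) (g # gs) id = g \<circ> foldr (\<circ>) gs id"
  by simp

lemma foldr_comp_append: "foldr (\<circ>) (gs @ hs) id = foldr (\<circ>) gs id \<circ> foldr (\<circ>) hs id"
  by (induction gs) (simp_all add: comp_assoc)

lemma shift_word:
  "set gs \<subseteq> D_gens n \<Longrightarrow> foldr (\<circ>) (map shift gs) id = shift (foldr (\<circ>) gs id)"
proof (induction gs)
  case (Cons g gs)
  then have "foldr (\<circ>) gs id \<in> signed_perms n"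
    using D_group_signed[of n] by (auto simp: D_group_words)
  moreover have "foldr (\<circ>) (map shift gs) id = shift (foldr (\<circ>) gs id)"
    using Cons.IH Cons.prems by (simp only: list.set insert_subset simp_thms)
  ultimately show ?case by (simp only: list.map foldr_comp_Cons shift_comp)
qed (simp only: list.map foldr_Nil id_apply shift_id)

text \<open>Reading a word from the right, each new generator raises the length of either the coset
  representative or the subgroup element by at most one. This gives both the
  existence of the decomposition and the lower bound for the length, without a count of
  inversions.\<close>

lemma coset_word_factor:
  assumes "set gs \<subseteq> D_gens (Suc n)"
  shows "\<exists>a\<in>coset_index (Suc n). \<exists>w\<in>D_group n. foldr (\<circ>) gs id = coset_rep (Suc n) a \<circ> shift w \<and>
    coset_length (Suc n) a + D_length n w \<le> length gs"
  using assms
proof (induction gs)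
  case Nil
  have "D_length n id \<le> 0" using D_length_le[of "[]" n] by simp
  moreover have "coset_length (Suc n) 1 = 0" "1 \<in> coset_index (Suc n)"
    by (auto simp: coset_index_def coset_length_def)
  ultimately show ?case
    unfolding foldr_Nil id_apply[of id]
    by (intro bexI[of _ 1] bexI[of _ id] conjI)
      (simp_all only: coset_rep_1 shift_id id_in_D_group comp_id list.size add_0 le_zero_eq)
next
  case (Cons g gs)
  then have "set gs \<subseteq> D_gens (Suc n)" and g: "g \<in> D_gens (Suc n)" by simp_all
  with Cons.IH obtain a w where aw: "a \<in> coset_index (Suc n)" "w \<in> D_group n"
    "foldr (\<circ>) gs id = coset_rep (Suc n) a \<circ> shift w"
    "coset_length (Suc n) a + D_length n w \<le> length gs" by blast
  from g aw(1) show ?case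
  proof (cases rule: coset_rep_step)
    case move
    have "foldr (\<circ>) (g # gs) id = coset_rep (Suc n) (g a) \<circ> shift w"
      by (simp only: foldr_comp_Cons aw(3) comp_assoc[symmetric] move(2))
    moreover have "coset_length (Suc n) (g a) + D_length n w \<le> length (g # gs)"
      using aw(4) move(3) by simp
    ultimately show ?thesis
      by (intro bexI[of _ "g a"] bexI[of _ w] conjI aw(2) move(1))
  next
    case (commute h)
    then have h: "h \<in> D_gens n" by simp
    have "foldr (\<circ>) (g # gs) id = coset_rep (Suc n) a \<circ> shift (h \<circ> w)"
      by (simp only: foldr_comp_Cons aw(3) comp_assoc[symmetric] commute(2)
          shift_comp[OF subsetD[OF D_group_signed aw(2)]])
    moreover have "coset_length (Suc n) a + D_length n (h \<circ> w) \<le> length (g # gs)"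
      using aw(4) D_group_gen_comp(2)[OF h aw(2)] by simp
    ultimately show ?thesis
      by (intro bexI[of _ a] bexI[of _ "h \<circ> w"] conjI aw(1) D_group_gen_comp(1)[OF h aw(2)])
  qed
qed

lemma coset_factor_in_D_group:
  assumes a: "a \<in> coset_index (Suc n)" and w: "w \<in> D_group n"
  shows "coset_rep (Suc n) a \<circ> shift w \<in> D_group (Suc n)"
    and "D_length (Suc n) (coset_rep (Suc n) a \<circ> shift w) \<le> coset_length (Suc n) a + D_length n w"
proof -
  obtain gs where gs: "set gs \<subseteq> D_gens (Suc n)" "length gs = coset_length (Suc n) a"
    "foldr (\<circ>) gs id = coset_rep (Suc n) a" using coset_rep_word[OF a] by blast
  obtain hs where hs: "set hs \<subseteq> D_gens n" "length hs = D_length n w" "foldr (\<circ>) hs id = w"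
    using D_length_word[OF w] .
  have word: "set (gs @ map shift hs) \<subseteq> D_gens (Suc n)" using gs(1) hs(1) shift_D_gens by auto
  have eq: "foldr (\<circ>) (gs @ map shift hs) id = coset_rep (Suc n) a \<circ> shift w"
    using gs hs by (simp only: foldr_comp_append shift_word)
  show "coset_rep (Suc n) a \<circ> shift w \<in> D_group (Suc n)"
    unfolding D_group_words mem_Collect_eq using word eq[symmetric]
    by (intro exI[of _ "gs @ map shift hs"] conjI)
  show "D_length (Suc n) (coset_rep (Suc n) a \<circ> shift w) \<le> coset_length (Suc n) a + D_length n w"
    using D_length_le[OF word] gs(2) hs(2) unfolding eq by simp
qed

lemma shift_in_D_group:
  assumes "w \<in> D_group n"
  shows "shift w \<in> D_group (Suc n)"
  using coset_factor_in_D_group(1)[of 1 n w] assms by (simp add: coset_rep_1 coset_index_def)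

lemma coset_rep_in_D_group:
  assumes "a \<in> coset_index (Suc n)"
  shows "coset_rep (Suc n) a \<in> D_group (Suc n)"
  using coset_factor_in_D_group(1)[OF assms id_in_D_group] by (simp add: shift_id)

lemma coset_rep_at_1: "a \<in> coset_index n \<Longrightarrow> coset_rep n a 1 = a"
  by (auto simp: coset_index_def coset_rep_def cycle_to_def flip_ends_def)

lemma inj_on_shift: "inj_on shift (signed_perms n)"
proof (rule inj_onI)
  fix v w assume v: "v \<in> signed_perms n" and w: "w \<in> signed_perms n" and eq: "shift v = shift w"
  show "v = w"
  proof (rule odd_fun_eqI)
    fix k :: int assume "k > 0"
    then have "v k + sgn (v k) = w k + sgn (w k)"
      using fun_cong[OF eq, of "k + 1"] by (simp add: shift_def Let_def)
    then show "v k = w k" by (auto simp: sgn_if split: if_splits)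
  qed (use v w in \<open>auto simp: signed_perms_def\<close>)
qed

lemma coset_factor_unique:
  assumes a: "a \<in> coset_index (Suc n)" "b \<in> coset_index (Suc n)"
    and w: "v \<in> D_group n" "w \<in> D_group n"
    and eq: "coset_rep (Suc n) a \<circ> shift v = coset_rep (Suc n) b \<circ> shift w"
  shows "a = b" "v = w"
proof -
  show ab: "a = b"
    using fun_cong[OF eq, of 1] coset_rep_at_1 a by (simp add: shift_def)
  have "bij (coset_rep (Suc n) b)"
    using coset_rep_in_D_group[OF a(2)] D_group_signed[of "Suc n"]
    by (auto simp: signed_perms_def intro: permutes_bij)
  then have "shift v = shift w" using eq unfolding ab by (auto simp: fun_eq_iff bij_def inj_def)
  then show "v = w" using inj_onD[OF inj_on_shift] w D_group_signed by blast
qed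

lemma D_group_Suc_bij:
  "bij_betw (\<lambda>(a, w). coset_rep (Suc n) a \<circ> shift w)
     (coset_index (Suc n) \<times> D_group n) (D_group (Suc n))"
proof (rule bij_betw_imageI)
  show "inj_on (\<lambda>(a, w). coset_rep (Suc n) a \<circ> shift w) (coset_index (Suc n) \<times> D_group n)"
    using coset_factor_unique by (auto intro!: inj_onI)
  show "(\<lambda>(a, w). coset_rep (Suc n) a \<circ> shift w) ` (coset_index (Suc n) \<times> D_group n) = D_group (Suc n)"
  proof (intro subset_antisym subsetI)
    fix \<sigma> assume "\<sigma> \<in> D_group (Suc n)"
    then obtain gs where "set gs \<subseteq> D_gens (Suc n)" "\<sigma> = foldr (\<circ>) gs id"
      by (auto simp: D_group_words)
    then show "\<sigma> \<in> (\<lambda>(a, w). coset_rep (Suc n) a \<circ> shift w) ` (coset_index (Suc n) \<times> D_group n)"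
      using coset_word_factor[of gs n] by force
  qed (auto intro: coset_factor_in_D_group)
qed

lemma D_length_coset_factor:
  assumes a: "a \<in> coset_index (Suc n)" and w: "w \<in> D_group n"
  shows "D_length (Suc n) (coset_rep (Suc n) a \<circ> shift w) = coset_length (Suc n) a + D_length n w"
proof (rule antisym)
  show "D_length (Suc n) (coset_rep (Suc n) a \<circ> shift w) \<le> coset_length (Suc n) a + D_length n w"
    by (rule coset_factor_in_D_group[OF a w])
  obtain gs where gs: "set gs \<subseteq> D_gens (Suc n)"
    "length gs = D_length (Suc n) (coset_rep (Suc n) a \<circ> shift w)"
    "foldr (\<circ>) gs id = coset_rep (Suc n) a \<circ> shift w"
    using D_length_word[OF coset_factor_in_D_group(1)[OF a w]] .
  then obtain b v where b: "b \<in> coset_index (Suc n)" "v \<in> D_group n"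
    "coset_rep (Suc n) a \<circ> shift w = coset_rep (Suc n) b \<circ> shift v"
    "coset_length (Suc n) b + D_length n v \<le> length gs"
    using coset_word_factor[of gs n] by auto
  then show "coset_length (Suc n) a + D_length n w \<le> D_length (Suc n) (coset_rep (Suc n) a \<circ> shift w)"
    using coset_factor_unique[OF a b(1) w b(2,3)] gs(2) by simp
qed

section \<open>Signed permutations of tensors\<close>

lemma inv_shift:
  assumes w: "w \<in> signed_perms n"
  shows "inv_into UNIV (shift w) = shift (inv_into UNIV w)"
proof (rule inv_unique_comp)
  have p: "w permutes {k. 1 \<le> \<bar>k\<bar> \<and> \<bar>k\<bar> \<le> int n}" using w by (simp add: signed_perms_def)
  show "shift w \<circ> shift (inv_into UNIV w) = id"
    unfolding shift_comp[OF inv_signed_perms[OF w], symmetric]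
    by (simp only: permutes_inv_o[OF p] shift_id)
  show "shift (inv_into UNIV w) \<circ> shift w = id"
    unfolding shift_comp[OF w, symmetric] by (simp only: permutes_inv_o[OF p] shift_id)
qed

lemma act_shift:
  assumes w: "w \<in> signed_perms (length ys)"
  shows "act J (shift w) (x # ys) = x # act J w ys"
proof (rule nth_equalityI)
  fix i assume "i < length (act J (shift w) (x # ys))"
  then have i: "i < Suc (length ys)" by simp
  show "act J (shift w) (x # ys) ! i = (x # act J w ys) ! i"
  proof (cases i)
    case 0
    then show ?thesis by (simp add: nth_act inv_shift[OF w] shift_def signed_nth_def)
  next
    case (Suc j)
    define v where "v = inv_into UNIV w (int j + 1)"
    have j: "j < length ys" using i Suc by simp
    then have v: "1 \<le> \<bar>v\<bar>" using signed_perms_range[OF inv_signed_perms[OF w], of "int j + 1"]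
      by (auto simp: v_def)
    have "shift (inv_into UNIV w) (int i + 1) = v + sgn v"
      using Suc by (simp add: shift_def v_def Let_def add.commute)
    then have "act J (shift w) (x # ys) ! i = signed_nth J (x # ys) (v + sgn v)"
      using i by (simp add: nth_act inv_shift[OF w])
    also have "\<dots> = signed_nth J ys v"
    proof (cases "v > 0")
      case True
      then have "nat (v + 1) = Suc (nat v)" "0 < nat v" by auto
      then show ?thesis using True by (simp add: signed_nth_def nth_Cons')
    next
      case False
      then have "nat (1 - v) = Suc (nat (- v))" "0 < nat (- v)" using v by auto
      then show ?thesis using False v by (simp add: signed_nth_def nth_Cons' sgn_if)
    qed
    also have "\<dots> = act J w ys ! j" using j by (simp add: nth_act v_def)
    finally show ?thesis using Suc by simp
  qed
qed simp

text \<open>Reindexing the product along \<open>i \<mapsto> \<bar>\<sigma>\<inverse> i\<bar>\<close> pairs the same factors; where the sign changes, the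
  involution moves across by selfadjointness.\<close>

lemma tensor_inner_act:
  assumes \<sigma>: "\<sigma> \<in> signed_perms n" and len: "length xs = n" "length ys = n"
    and J: "\<And>x y. cinner (J x) y = cinner x (J y)"
  shows "tensor_inner xs (act J \<sigma> ys) = tensor_inner (act J (inv_into UNIV \<sigma>) xs) ys"
proof -
  let ?\<tau> = "inv_into UNIV \<sigma>"
  have \<tau>: "?\<tau> \<in> signed_perms n" by (rule inv_signed_perms[OF \<sigma>])
  have perm: "\<sigma> permutes {k. 1 \<le> \<bar>k\<bar> \<and> \<bar>k\<bar> \<le> int n}"
    and neg: "\<sigma> (- j) = - \<sigma> j" "?\<tau> (- j) = - ?\<tau> j" for j
    using \<sigma> \<tau> by (auto simp: signed_perms_def)
  have inv: "\<sigma> (?\<tau> j) = j" "?\<tau> (\<sigma> j) = j" for j using permutes_inverses[OF perm] by auto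
  have invinv: "inv_into UNIV ?\<tau> = \<sigma>" using perm by (simp add: permutes_inv_inv)
  \<comment> \<open>The 0-based position of the point to which \<open>\<rho>\<close> sends the 0-based position \<open>i\<close>.\<close>
  define p where "p \<rho> i = nat \<bar>\<rho> (int i + 1)\<bar> - 1" for \<rho> :: "int \<Rightarrow> int" and i
  have p: "p \<rho> i < n" "int (p \<rho> i) + 1 = \<bar>\<rho> (int i + 1)\<bar>"
    if "\<rho> \<in> signed_perms n" "i < n" for \<rho> i
    using signed_perms_range[OF that(1), of "int i + 1"] that(2) by (auto simp: p_def)
  have pp: "p \<rho>' (p \<rho> i) = i"
    if "\<rho> \<in> signed_perms n" "i < n" "\<And>j. \<rho>' (\<rho> j) = j" "\<And>j. \<rho>' (- j) = - \<rho>' j" for \<rho> \<rho>' i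
  proof -
    have "\<bar>\<rho>' \<bar>\<rho> (int i + 1)\<bar>\<bar> = int i + 1"
      using that(3)[of "int i + 1"] that(4)[of "\<rho> (int i + 1)"]
      by (cases "\<rho> (int i + 1) \<ge> 0") auto
    then show ?thesis unfolding p_def[of \<rho>'] p(2)[OF that(1,2)] by simp
  qed
  have "(\<Prod>i<n. cinner (xs ! i) (act J \<sigma> ys ! i)) = (\<Prod>j<n. cinner (act J ?\<tau> xs ! j) (ys ! j))"
  proof (rule prod.reindex_bij_witness[of _ "p \<sigma>" "p ?\<tau>"])
    fix i assume "i \<in> {..<n}"
    then have i: "i < n" by simp
    show "p \<sigma> (p ?\<tau> i) = i" by (rule pp[OF \<tau> i]) (simp_all add: inv neg)
    show "p ?\<tau> i \<in> {..<n}" using p[OF \<tau> i] by simp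
    define k where "k = ?\<tau> (int i + 1)"
    have \<sigma>k: "\<sigma> k = int i + 1" by (simp add: k_def inv)
    have k: "1 \<le> \<bar>k\<bar>" "int (p ?\<tau> i) + 1 = \<bar>k\<bar>"
      using signed_perms_range[OF \<tau>, of "int i + 1"] i p(2)[OF \<tau> i] by (auto simp: k_def)
    have "act J ?\<tau> xs ! p ?\<tau> i = signed_nth J xs (\<sigma> \<bar>k\<bar>)"
      using p[OF \<tau> i] k by (simp add: nth_act len invinv)
    moreover have "act J \<sigma> ys ! i = signed_nth J ys k"
      using i by (simp add: nth_act len k_def)
    ultimately show "cinner (act J ?\<tau> xs ! p ?\<tau> i) (ys ! p ?\<tau> i) = cinner (xs ! i) (act J \<sigma> ys ! i)"
      using k \<sigma>k neg(1)[of k] J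
      by (cases "k > 0") (auto simp: signed_nth_def p_def k_def nat_add_distrib)
  next
    fix j assume "j \<in> {..<n}"
    then have j: "j < n" by simp
    show "p ?\<tau> (p \<sigma> j) = j" by (rule pp[OF \<sigma> j]) (simp_all add: inv neg)
    show "p \<sigma> j \<in> {..<n}" using p[OF \<sigma> j] by simp
  qed
  then show ?thesis using len by (simp add: tensor_inner_def)
qed

text \<open>Generators are involutions, so reversing a word inverts it; hence lengths are invariant under
  inversion, which is what makes \<open>P_hat\<close> selfadjoint.\<close>

lemma foldr_comp_rev_inverse:
  assumes "set gs \<subseteq> D_gens n"
  shows "foldr (\<circ>) (rev gs) id \<circ> foldr (\<circ>) gs id = id"
  using assms
proof (induction gs)
  case (Cons g gs)
  have "foldr (\<circ>) (rev (g # gs)) id = foldr (\<circ>) (rev gs) id \<circ> g"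
    by (simp only: rev.simps foldr_comp_append foldr_comp_Cons foldr_Nil id_apply[of id] comp_id)
  moreover have "g \<circ> (g \<circ> h) = h" for h :: "int \<Rightarrow> int"
    using Cons.prems D_gens_invol[of g n] by (auto simp: fun_eq_iff)
  moreover have "foldr (\<circ>) (rev gs) id \<circ> foldr (\<circ>) gs id = id" 
    using Cons.IH Cons.prems by (simp only: list.set insert_subset simp_thms)
  ultimately show ?case by (simp only: foldr_comp_Cons comp_assoc)
qed (simp only: rev.simps foldr_Nil id_apply[of id] comp_id)

lemma
  assumes "\<sigma> \<in> D_group n"
  shows inv_D_group: "inv_into UNIV \<sigma> \<in> D_group n"
    and D_length_inv_le: "D_length n (inv_into UNIV \<sigma>) \<le> D_length n \<sigma>"
proof -
  obtain gs where gs: "set gs \<subseteq> D_gens n" "length gs = D_length n \<sigma>" "foldr (\<circ>) gs id = \<sigma>"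
    using D_length_word[OF assms] .
  have "foldr (\<circ>) gs id \<circ> foldr (\<circ>) (rev gs) id = id"
    using foldr_comp_rev_inverse[of "rev gs" n] gs(1) by (simp only: rev_rev_ident set_rev)
  then have inv: "inv_into UNIV \<sigma> = foldr (\<circ>) (rev gs) id"
    using foldr_comp_rev_inverse[OF gs(1)] unfolding gs(3) by (rule inv_unique_comp)
  have rev: "set (rev gs) \<subseteq> D_gens n" using gs(1) by simp
  then show "inv_into UNIV \<sigma> \<in> D_group n"
    unfolding inv D_group_words mem_Collect_eq by blast
  show "D_length n (inv_into UNIV \<sigma>) \<le> D_length n \<sigma>"
    using D_length_le[OF rev] gs(2) unfolding inv by simp
qed

lemma inv_inv_D_group: "\<sigma> \<in> D_group n \<Longrightarrow> inv_into UNIV (inv_into UNIV \<sigma>) = \<sigma>"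
  using D_group_signed[of n] by (auto simp: signed_perms_def permutes_inv_inv)

lemma D_length_inv: "\<sigma> \<in> D_group n \<Longrightarrow> D_length n (inv_into UNIV \<sigma>) = D_length n \<sigma>"
  using D_length_inv_le[of \<sigma> n] D_length_inv_le[OF inv_D_group, of \<sigma> n] inv_inv_D_group[of \<sigma> n]
  by (intro antisym) simp_all

section \<open>The deformed inner product\<close>

lemma sesquilinear_zero_left: "sesquilinear B \<Longrightarrow> B 0 g = 0"
  unfolding sesquilinear_def by (metis complex_cnj_zero mult_zero_left scaleC_zero_left)

lemma sesquilinear_scaleC_left: "sesquilinear B \<Longrightarrow> B (c *\<^sub>C f) g = cnj c * B f g"
  by (simp add: sesquilinear_def)

lemma sesquilinear_fock_eqI:
  fixes B C :: "'a::complex_vector fock \<Rightarrow> 'a fock \<Rightarrow> complex"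
  assumes B: "sesquilinear B" and C: "sesquilinear C"
    and eq: "\<And>xs ys. B (tensor xs) (tensor ys) = C (tensor xs) (tensor ys)"
  shows "B f g = C f g"
proof -
  have "B f = C f"
  proof (induction f rule: fock_induct)
    case zero
    show ?case by (simp add: fun_eq_iff sesquilinear_zero_left[OF B] sesquilinear_zero_left[OF C])
  next
    case (tensor xs)
    show ?case by (rule clinear_fock_eqI) (use B C eq in \<open>auto simp: sesquilinear_def\<close>)
  qed (use B C in \<open>auto simp: sesquilinear_def fun_eq_iff\<close>)
  then show ?thesis by simp
qed

lemma sesquilinear_comp:
  assumes "sesquilinear B" "clinear S" "clinear T"
  shows "sesquilinear (\<lambda>f g. B (S f) (T g))"
  using assms unfolding sesquilinear_def clinear_def by auto

lemma sesquilinear_cnj_swap: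
  assumes "sesquilinear B"
  shows "sesquilinear (\<lambda>f g. cnj (B g f))"
  using assms unfolding sesquilinear_def clinear_def by (auto simp: scaleC_complex_def)

lemma sesquilinear_sum_right:
  assumes "sesquilinear B"
  shows "B f (\<Sum>i\<in>I. c i *\<^sub>C h i) = (\<Sum>i\<in>I. c i * B f (h i))"
proof -
  have lin: "clinear (B f)" using assms by (simp add: sesquilinear_def)
  show ?thesis
    by (induction I rule: infinite_finite_induct)
      (simp_all add: clinear_zero[OF lin] clinear_add[OF lin] clinear_scaleC[OF lin] scaleC_complex_def)
qed

lemma sesquilinear_sum_left:
  assumes "sesquilinear B"
  shows "B (\<Sum>i\<in>I. c i *\<^sub>C h i) g = (\<Sum>i\<in>I. cnj (c i) * B (h i) g)"
proof -
  have "cnj (B (\<Sum>i\<in>I. c i *\<^sub>C h i) g) = (\<Sum>i\<in>I. c i * cnj (B (h i) g))"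
    using sesquilinear_sum_right[OF sesquilinear_cnj_swap[OF assms]] .
  then have "cnj (cnj (B (\<Sum>i\<in>I. c i *\<^sub>C h i) g)) = cnj (\<Sum>i\<in>I. c i * cnj (B (h i) g))" by simp
  then show ?thesis by simp
qed

lemma clinear_id: "clinear (\<lambda>x. x)"
  by (simp add: clinear_def)

lemma clinear_creation: "clinear (creation x)"
  unfolding creation_def by (rule clinear_lin_ext[OF multilinear_creation])

lemma sesquilinear_fock_inner:
  assumes "clinear J" shows "sesquilinear (fock_inner J q)"
  using sesquilinear_comp[OF sesquilinear_fock_inner_0 clinear_id P_hat_tensor(2)[OF assms]]
  unfolding fock_inner_def .

lemma fock_inner_tensor:
  assumes "clinear J"
  shows "fock_inner J q (tensor xs) (tensor ys) =
    (\<Sum>\<sigma>\<in>D_group (length ys).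
      complex_of_real (q ^ D_length (length ys) \<sigma>) * tensor_inner xs (act J \<sigma> ys))"
  unfolding fock_inner_def P_hat_tensor(1)[OF assms]
    sesquilinear_sum_right[OF sesquilinear_fock_inner_0] fock_inner_0_tensor ..

lemma tensor_inner_length: "length xs \<noteq> length ys \<Longrightarrow> tensor_inner xs ys = 0"
  by (simp add: tensor_inner_def)

text \<open>The substitution \<open>\<sigma> \<mapsto> \<sigma>\<inverse>\<close> in the sum that defines \<open>P_hat\<close> moves the group action to the left
  argument and preserves the coefficients.\<close>

lemma fock_inner_commute:
  assumes J: "selfadjoint_involution J"
  shows "fock_inner J q f g = cnj (fock_inner J q g f)"
proof (rule sesquilinear_fock_eqI[where B = "fock_inner J q" and C = "\<lambda>f g. cnj (fock_inner J q g f)"])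
  have lin: "clinear J" and sa: "\<And>x y. cinner (J x) y = cinner x (J y)"
    using J by (auto simp: selfadjoint_involution_def)
  note ses = sesquilinear_fock_inner[OF lin]
  show "sesquilinear (fock_inner J q)" by (rule ses)
  show "sesquilinear (\<lambda>f g. cnj (fock_inner J q g f))" by (rule sesquilinear_cnj_swap[OF ses])
  fix xs ys :: "'a list"
  show "fock_inner J q (tensor xs) (tensor ys) = cnj (fock_inner J q (tensor ys) (tensor xs))"
  proof (cases "length xs = length ys")
    case False
    then show ?thesis by (simp add: fock_inner_tensor[OF lin] tensor_inner_length)
  next
    case True
    have "fock_inner J q (tensor xs) (tensor ys) =
      (\<Sum>\<sigma>\<in>D_group (length ys). complex_of_real (q ^ D_length (length ys) (inv_into UNIV \<sigma>)) *
        tensor_inner xs (act J (inv_into UNIV \<sigma>) ys))"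
      unfolding fock_inner_tensor[OF lin]
      by (rule sum.reindex_bij_witness[of _ "inv_into UNIV" "inv_into UNIV"])
        (simp_all add: inv_D_group inv_inv_D_group)
    also have "\<dots> = (\<Sum>\<sigma>\<in>D_group (length xs). complex_of_real (q ^ D_length (length xs) \<sigma>) *
        tensor_inner (act J \<sigma> xs) ys)"
    proof (rule sum.cong)
      fix \<sigma> assume \<sigma>: "\<sigma> \<in> D_group (length xs)"
      then have "inv_into UNIV \<sigma> \<in> signed_perms (length ys)"
        using inv_D_group D_group_signed True by fastforce
      from tensor_inner_act[OF this True refl sa] show
        "complex_of_real (q ^ D_length (length ys) (inv_into UNIV \<sigma>)) *
           tensor_inner xs (act J (inv_into UNIV \<sigma>) ys) =
         complex_of_real (q ^ D_length (length xs) \<sigma>) * tensor_inner (act J \<sigma> xs) ys"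
        using \<sigma> True by (simp add: D_length_inv inv_inv_D_group)
    qed (simp add: True)
    also have "\<dots> = cnj (fock_inner J q (tensor ys) (tensor xs))"
      by (simp add: fock_inner_tensor[OF lin] tensor_inner_commute[of ys])
    finally show ?thesis .
  qed
qed

section \<open>An explicit adjoint of the creation operator\<close>

text \<open>The annihilation operator of the full Fock space, which is the case \<open>q = 0\<close>.\<close>

definition contract :: "'a::complex_hilbert \<Rightarrow> 'a fock \<Rightarrow> 'a fock" where
  "contract x = lin_ext (\<lambda>zs. case zs of [] \<Rightarrow> 0 | z # zs' \<Rightarrow> cinner x z *\<^sub>C tensor zs')"

lemma
  shows clinear_contract: "clinear (contract x)"
    and contract_tensor_Nil: "contract x (tensor []) = 0"
    and contract_tensor_Cons: "contract x (tensor (z # zs)) = cinner x z *\<^sub>C tensor zs"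
proof -
  have "multilinear (\<lambda>zs. case zs of [] \<Rightarrow> 0 | z # zs' \<Rightarrow> cinner x z *\<^sub>C tensor zs')"
    unfolding multilinear_def
  proof (intro allI)
    fix us vs :: "'a list"
    have tens: "clinear (\<lambda>y. tensor (ws @ y # vs))" for ws
      using multilinear_tensor by (auto simp: multilinear_def)
    show "clinear (\<lambda>y. case us @ y # vs of [] \<Rightarrow> 0 | z # zs' \<Rightarrow> cinner x z *\<^sub>C tensor zs')"
    proof (cases us)
      case Nil
      then show ?thesis
        by (auto intro!: clinearI simp: cinner_add_right cinner_scaleC_right scaleC_add_left scaleC_scaleC)
    next
      case (Cons u ws)
      then show ?thesis
        by (auto intro!: clinearI simp: clinear_add[OF tens] clinear_scaleC[OF tens]
            scaleC_add_right scaleC_scaleC mult.commute)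
    qed
  qed
  note * = clinear_lin_ext[OF this] lin_ext_tensor[OF this]
  show "clinear (contract x)" "contract x (tensor []) = 0"
    "contract x (tensor (z # zs)) = cinner x z *\<^sub>C tensor zs"
    unfolding contract_def by (simp_all add: *)
qed

lemma fock_inner_0_contract: "fock_inner_0 (contract x f) g = fock_inner_0 f (creation x g)"
proof (rule sesquilinear_fock_eqI[where B = "\<lambda>f. fock_inner_0 (contract x f)"
      and C = "\<lambda>f g. fock_inner_0 f (creation x g)"])
  note ses = sesquilinear_fock_inner_0
  show "sesquilinear (\<lambda>f. fock_inner_0 (contract x f))"
    using sesquilinear_comp[OF ses clinear_contract clinear_id] .
  show "sesquilinear (\<lambda>f g. fock_inner_0 f (creation x g))"
    using sesquilinear_comp[OF ses clinear_id clinear_creation] .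
  fix us ys :: "'a list"
  show "fock_inner_0 (contract x (tensor us)) (tensor ys) =
      fock_inner_0 (tensor us) (creation x (tensor ys))"
  proof (cases us)
    case Nil
    then show ?thesis
      by (simp add: contract_tensor_Nil sesquilinear_zero_left[OF ses] creation_tensor
          fock_inner_0_tensor tensor_inner_length)
  next
    case (Cons z zs)
    have "fock_inner_0 (contract x (tensor us)) (tensor ys) = cinner z x * tensor_inner zs ys"
      by (simp add: Cons contract_tensor_Cons sesquilinear_scaleC_left[OF ses] fock_inner_0_tensor
          cinner_commute[of z x])
    also have "\<dots> = tensor_inner (z # zs) (x # ys)"
      by (simp add: tensor_inner_def prod.lessThan_Suc_shift del: prod.lessThan_Suc)
    finally show ?thesis by (simp add: Cons creation_tensor fock_inner_0_tensor)
  qed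
qed

text \<open>Contraction against \<open>x\<close> after the adjoint of the sum of all \<open>q\<close>-weighted coset representatives.\<close>

definition coset_annihilation :: "('a::complex_hilbert \<Rightarrow> 'a) \<Rightarrow> real \<Rightarrow> 'a \<Rightarrow> 'a fock \<Rightarrow> 'a fock" where
  "coset_annihilation J q x = lin_ext (\<lambda>us. \<Sum>a\<in>coset_index (length us).
     complex_of_real (q ^ coset_length (length us) a) *\<^sub>C
       contract x (tensor (act J (inv_into UNIV (coset_rep (length us) a)) us)))"

lemma coset_rep_signed:
  assumes "a \<in> coset_index n"
  shows "coset_rep n a \<in> signed_perms n"
proof -
  from assms obtain k where "n = Suc k" by (cases n) (auto simp: coset_index_def)
  then show ?thesis using assms coset_rep_in_D_group[of a k] D_group_signed by blast
qed

lemma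
  assumes J: "clinear J"
  shows clinear_coset_annihilation: "clinear (coset_annihilation J q x)"
    and coset_annihilation_tensor: "coset_annihilation J q x (tensor us) =
      (\<Sum>a\<in>coset_index (length us). complex_of_real (q ^ coset_length (length us) a) *\<^sub>C
         contract x (tensor (act J (inv_into UNIV (coset_rep (length us) a)) us)))"
proof -
  have "multilinear (\<lambda>us. \<Sum>a\<in>coset_index (length us). complex_of_real (q ^ coset_length (length us) a) *\<^sub>C
     contract x (tensor (act J (inv_into UNIV (coset_rep (length us) a)) us)))"
    unfolding multilinear_def
  proof (intro allI)
    fix us vs :: "'a list"
    let ?n = "length us + Suc (length vs)"
    have "clinear (\<lambda>y. \<Sum>a\<in>coset_index ?n. c a *\<^sub>C
       contract x (tensor (act J (inv_into UNIV (coset_rep ?n a)) (us @ y # vs))))" for c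
    proof (rule clinear_sum_scaleC)
      fix a assume "a \<in> coset_index ?n"
      from clinear_tensor_act[OF J inv_signed_perms[OF coset_rep_signed[OF this]]]
      show "clinear (\<lambda>y. contract x (tensor (act J (inv_into UNIV (coset_rep ?n a)) (us @ y # vs))))"
        using clinear_contract[of x] by (simp add: clinear_def)
    qed
    then show "clinear (\<lambda>y. \<Sum>a\<in>coset_index (length (us @ y # vs)).
        complex_of_real (q ^ coset_length (length (us @ y # vs)) a) *\<^sub>C
          contract x (tensor (act J (inv_into UNIV (coset_rep (length (us @ y # vs)) a)) (us @ y # vs))))"
      by (simp only: length_append list.size(4) add_0_right One_nat_def add_Suc_right)
  qed
  note * = clinear_lin_ext[OF this] lin_ext_tensor[OF this]
  show "clinear (coset_annihilation J q x)" "coset_annihilation J q x (tensor us) =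
      (\<Sum>a\<in>coset_index (length us). complex_of_real (q ^ coset_length (length us) a) *\<^sub>C
         contract x (tensor (act J (inv_into UNIV (coset_rep (length us) a)) us)))"
    unfolding coset_annihilation_def by (fact *)+
qed

text \<open>The factorization of \<open>P_hat\<close> behind the adjoint: the subgroup that fixes \<open>1\<close> acts on \<open>ys\<close> and
  leaves the first factor \<open>x\<close> in place.\<close>

lemma P_hat_creation_tensor:
  assumes J: "selfadjoint_involution J"
  shows "P_hat J q (creation x (tensor ys)) =
    (\<Sum>a\<in>coset_index (Suc (length ys)). \<Sum>w\<in>D_group (length ys).
       complex_of_real (q ^ (coset_length (Suc (length ys)) a + D_length (length ys) w)) *\<^sub>C
         tensor (act J (coset_rep (Suc (length ys)) a) (x # act J w ys)))"
proof -
  let ?n = "length ys"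
  have lin: "clinear J" and JJ: "\<And>x. J (J x) = x"
    using J by (auto simp: selfadjoint_involution_def)
  have "P_hat J q (creation x (tensor ys)) = (\<Sum>\<sigma>\<in>D_group (Suc ?n).
     complex_of_real (q ^ D_length (Suc ?n) \<sigma>) *\<^sub>C tensor (act J \<sigma> (x # ys)))"
    by (simp add: creation_tensor P_hat_tensor(1)[OF lin])
  also have "\<dots> = (\<Sum>(a, w)\<in>coset_index (Suc ?n) \<times> D_group ?n.
     complex_of_real (q ^ D_length (Suc ?n) (coset_rep (Suc ?n) a \<circ> shift w)) *\<^sub>C
       tensor (act J (coset_rep (Suc ?n) a \<circ> shift w) (x # ys)))"
    by (subst sum.reindex_bij_betw[OF D_group_Suc_bij, symmetric]) (simp add: case_prod_unfold)
  also have "\<dots> = (\<Sum>(a, w)\<in>coset_index (Suc ?n) \<times> D_group ?n.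
     complex_of_real (q ^ (coset_length (Suc ?n) a + D_length ?n w)) *\<^sub>C
       tensor (act J (coset_rep (Suc ?n) a) (x # act J w ys)))"
  proof (intro sum.cong refl, clarify)
    fix a w assume a: "a \<in> coset_index (Suc ?n)" and w: "w \<in> D_group ?n"
    have ws: "w \<in> signed_perms ?n" using w D_group_signed by blast
    have "shift w \<in> signed_perms (Suc ?n)" using shift_in_D_group[OF w] D_group_signed by blast
    then have "act J (coset_rep (Suc ?n) a \<circ> shift w) (x # ys) =
        act J (coset_rep (Suc ?n) a) (x # act J w ys)"
      using act_comp[of "coset_rep (Suc ?n) a" "x # ys" "shift w" J] coset_rep_signed[OF a] JJ
        act_shift[OF ws] by simp
    then show "complex_of_real (q ^ D_length (Suc ?n) (coset_rep (Suc ?n) a \<circ> shift w)) *\<^sub>C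
       tensor (act J (coset_rep (Suc ?n) a \<circ> shift w) (x # ys)) =
      complex_of_real (q ^ (coset_length (Suc ?n) a + D_length ?n w)) *\<^sub>C
       tensor (act J (coset_rep (Suc ?n) a) (x # act J w ys))"
      by (simp only: D_length_coset_factor[OF a w])
  qed
  finally show ?thesis by (simp only: sum.cartesian_product)
qed

text \<open>The inner representatives are moved to the left by \<open>tensor_inner_act\<close>, and contraction is adjoint
  to creation for the undeformed inner product.\<close>

lemma coset_annihilation_adjoint:
  assumes J: "selfadjoint_involution J"
  shows "fock_inner J q (coset_annihilation J q x f) g = fock_inner J q f (creation x g)"
proof (rule sesquilinear_fock_eqI[where B = "\<lambda>f. fock_inner J q (coset_annihilation J q x f)"
      and C = "\<lambda>f g. fock_inner J q f (creation x g)"])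
  have lin: "clinear J" and sa: "\<And>x y. cinner (J x) y = cinner x (J y)"
    using J by (auto simp: selfadjoint_involution_def)
  note ses = sesquilinear_fock_inner[OF lin, of q] and ses0 = sesquilinear_fock_inner_0
  show "sesquilinear (\<lambda>f. fock_inner J q (coset_annihilation J q x f))"
    using sesquilinear_comp[OF ses clinear_coset_annihilation[OF lin] clinear_id] .
  show "sesquilinear (\<lambda>f g. fock_inner J q f (creation x g))"
    using sesquilinear_comp[OF ses clinear_id clinear_creation] .
  fix us ys :: "'a list"
  let ?n = "length ys" and ?N = "length us"
  let ?c = "\<lambda>a. complex_of_real (q ^ coset_length ?N a)"
  let ?v = "\<lambda>a. act J (inv_into UNIV (coset_rep ?N a)) us"
  let ?d = "\<lambda>w. complex_of_real (q ^ D_length ?n w)"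
  have "fock_inner J q (coset_annihilation J q x (tensor us)) (tensor ys) =
      (\<Sum>a\<in>coset_index ?N. ?c a * fock_inner_0 (tensor (?v a)) (creation x (P_hat J q (tensor ys))))"
    unfolding fock_inner_def coset_annihilation_tensor[OF lin] sesquilinear_sum_left[OF ses0]
      fock_inner_0_contract by simp
  also have "\<dots> = (\<Sum>a\<in>coset_index ?N. \<Sum>w\<in>D_group ?n. ?c a * ?d w *
      tensor_inner (?v a) (x # act J w ys))"
  proof (rule sum.cong[OF refl])
    fix a
    have "creation x (P_hat J q (tensor ys)) = (\<Sum>w\<in>D_group ?n. ?d w *\<^sub>C tensor (x # act J w ys))"
    proof -
      have "creation x (\<Sum>w\<in>W. ?d w *\<^sub>C tensor (act J w ys)) = (\<Sum>w\<in>W. ?d w *\<^sub>C tensor (x # act J w ys))"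
        for W
        by (induction W rule: infinite_finite_induct)
          (simp_all add: clinear_zero[OF clinear_creation] clinear_add[OF clinear_creation]
            clinear_scaleC[OF clinear_creation] creation_tensor)
      then show ?thesis by (simp only: P_hat_tensor(1)[OF lin])
    qed
    then show "?c a * fock_inner_0 (tensor (?v a)) (creation x (P_hat J q (tensor ys))) =
      (\<Sum>w\<in>D_group ?n. ?c a * ?d w * tensor_inner (?v a) (x # act J w ys))"
      by (simp add: sesquilinear_sum_right[OF ses0] fock_inner_0_tensor sum_distrib_left mult.assoc)
  qed
  also have "\<dots> = fock_inner J q (tensor us) (creation x (tensor ys))"
  proof (cases "?N = Suc ?n")
    case False
    then have "tensor_inner (?v a) (x # act J w ys) = 0" for a w
      by (intro tensor_inner_length) simp
    moreover have "fock_inner J q (tensor us) (creation x (tensor ys)) = 0"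
      using False by (simp add: creation_tensor fock_inner_tensor[OF lin] tensor_inner_length)
    ultimately show ?thesis by simp
  next
    case True
    have "tensor_inner (?v a) (x # act J w ys) =
        tensor_inner us (act J (coset_rep (Suc ?n) a) (x # act J w ys))"
      if "a \<in> coset_index ?N" for a w
      using tensor_inner_act[OF coset_rep_signed[OF that] refl, of "x # act J w ys" J] True sa
      by simp
    then show ?thesis
      by (simp add: fock_inner_def P_hat_creation_tensor[OF J] True sum.cartesian_product
          case_prod_unfold sesquilinear_sum_right[OF ses0] fock_inner_0_tensor power_add)
  qed
  finally show "fock_inner J q (coset_annihilation J q x (tensor us)) (tensor ys) =
      fock_inner J q (tensor us) (creation x (tensor ys))" .
qed

section \<open>Moments do not depend on the choice of the adjoint\<close>

lemma
  assumes J: "selfadjoint_involution J"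
  shows clinear_annihilation: "clinear (annihilation J q x)"
    and annihilation_adjoint: "fock_inner J q (annihilation J q x f) g = fock_inner J q f (creation x g)"
proof -
  have "clinear J" using J by (simp add: selfadjoint_involution_def)
  then have "\<exists>A. clinear A \<and> (\<forall>f g. fock_inner J q (A f) g = fock_inner J q f (creation x g))"
    using clinear_coset_annihilation coset_annihilation_adjoint[OF J] by blast
  from someI_ex[OF this] show "clinear (annihilation J q x)"
    "fock_inner J q (annihilation J q x f) g = fock_inner J q f (creation x g)"
    unfolding annihilation_def by blast+
qed

text \<open>The form may be degenerate for general real \<open>q\<close>, and then the creation operator can have several
  adjoints; they agree up to null vectors.\<close>

definition null_vector :: "('a::complex_hilbert \<Rightarrow> 'a) \<Rightarrow> real \<Rightarrow> 'a fock \<Rightarrow> bool" where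
  "null_vector J q f \<longleftrightarrow> (\<forall>g. fock_inner J q f g = 0)"

lemma clinear_gaussian:
  assumes "selfadjoint_involution J"
  shows "clinear (gaussian J q x)"
  using clinear_annihilation[OF assms, of q x] clinear_creation[of x]
  unfolding clinear_def gaussian_def by (simp add: scaleC_add_right)

text \<open>For the creation part, a null vector \<open>f\<close> is moved to the other side of the form by symmetry,
  where creation turns into annihilation of the other argument.\<close>

lemma null_vector_gaussian:
  assumes J: "selfadjoint_involution J" and null: "null_vector J q f"
  shows "null_vector J q (gaussian J q x f)"
proof -
  have lin: "clinear J" using J by (simp add: selfadjoint_involution_def)
  have "fock_inner J q (creation x f) g = 0" for g
  proof -
    have "fock_inner J q (creation x f) g = cnj (fock_inner J q (annihilation J q x g) f)"
      by (simp add: fock_inner_commute[OF J, of q "creation x f"] annihilation_adjoint[OF J])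
    also have "\<dots> = fock_inner J q f (annihilation J q x g)"
      by (simp add: fock_inner_commute[OF J, of q f])
    finally show ?thesis using null by (simp add: null_vector_def)
  qed
  then show ?thesis
    using null sesquilinear_fock_inner[OF lin, of q]
    by (simp add: null_vector_def gaussian_def sesquilinear_def annihilation_adjoint[OF J])
qed

definition moment :: "('a::complex_hilbert \<Rightarrow> 'a) \<Rightarrow> real \<Rightarrow> (nat \<Rightarrow> 'a) \<Rightarrow> nat \<Rightarrow> 'a fock \<Rightarrow> complex" where
  "moment J q x k f = fock_inner J q vacuum (foldr (\<lambda>i. gaussian J q (x i)) [1..<k + 1] f)"

lemma moment_Suc: "moment J q x (Suc k) f = moment J q x k (gaussian J q (x (Suc k)) f)"
  by (simp add: moment_def)

lemma clinear_moment:
  assumes "selfadjoint_involution J"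
  shows "clinear (moment J q x k)"
proof (induction k)
  case 0
  have "clinear J" using assms by (simp add: selfadjoint_involution_def)
  then show ?case
    using sesquilinear_fock_inner[of J q] by (simp add: moment_def sesquilinear_def clinear_def)
next
  case (Suc k)
  then show ?case using clinear_gaussian[OF assms] by (simp add: clinear_def moment_Suc)
qed

lemma moment_null_vector:
  assumes J: "selfadjoint_involution J"
  shows "null_vector J q f \<Longrightarrow> moment J q x k f = 0"
proof (induction k arbitrary: f)
  case 0
  then show ?case
    using fock_inner_commute[OF J, of q vacuum f] by (simp add: moment_def null_vector_def)
next
  case (Suc k)
  then show ?case using null_vector_gaussian[OF J] by (simp add: moment_Suc)
qed

text \<open>The two adjoints differ by null vectors, on which all moments vanish.\<close>

lemma moment_Suc_coset:
  assumes J: "selfadjoint_involution J"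
  shows "moment J q x (Suc k) f =
    moment J q x k (creation (x (Suc k)) f) + moment J q x k (coset_annihilation J q (x (Suc k)) f)"
proof -
  let ?y = "x (Suc k)"
  have lin: "clinear J" using J by (simp add: selfadjoint_involution_def)
  let ?d = "annihilation J q ?y f - coset_annihilation J q ?y f"
  have "fock_inner J q ?d g = 0" for g
  proof -
    have "fock_inner J q ?d g = fock_inner J q (annihilation J q ?y f + (- 1) *\<^sub>C coset_annihilation J q ?y f) g"
      by (simp add: scaleC_minus_one)
    also have "\<dots> = 0"
      using sesquilinear_fock_inner[OF lin, of q]
      by (simp add: sesquilinear_def annihilation_adjoint[OF J] coset_annihilation_adjoint[OF J])
    finally show ?thesis .
  qed
  then have "moment J q x k ?d = 0" by (intro moment_null_vector[OF J]) (simp add: null_vector_def)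
  then have "moment J q x k (annihilation J q ?y f) = moment J q x k (coset_annihilation J q ?y f)"
    by (simp add: clinear_diff[OF clinear_moment[OF J]])
  then show ?thesis
    by (simp add: moment_Suc gaussian_def clinear_add[OF clinear_moment[OF J]])
qed

section \<open>The recursion for moments\<close>

definition remove_nth :: "nat \<Rightarrow> 'b list \<Rightarrow> 'b list" where
  "remove_nth p xs = take p xs @ drop (Suc p) xs"

text \<open>On vectors fixed by the involution the sign of \<open>a\<close> has no effect: in both cases the representative
  brings the factor number \<open>\<bar>a\<bar>\<close> to the front.\<close>

lemma act_inv_coset_rep_fixed:
  assumes a: "a \<in> coset_index (length us)" and fixed: "\<And>u. u \<in> set us \<Longrightarrow> J u = u"
  shows "act J (inv_into UNIV (coset_rep (length us) a)) us =
    us ! (nat \<bar>a\<bar> - 1) # remove_nth (nat \<bar>a\<bar> - 1) us"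
proof (rule nth_equalityI)
  let ?n = "length us" and ?p = "nat \<bar>a\<bar> - 1"
  have p: "?p < ?n" "int ?p + 1 = \<bar>a\<bar>" using a by (auto simp: coset_index_def)
  show "length (act J (inv_into UNIV (coset_rep ?n a)) us) = length (us ! ?p # remove_nth ?p us)"
    using p by (simp add: remove_nth_def)
  fix i assume "i < length (act J (inv_into UNIV (coset_rep ?n a)) us)"
  then have i: "i < ?n" by simp
  have signed: "coset_rep ?n a \<in> signed_perms ?n" by (rule coset_rep_signed[OF a])
  then have invinv: "inv_into UNIV (inv_into UNIV (coset_rep ?n a)) = coset_rep ?n a"
    by (auto simp: signed_perms_def permutes_inv_inv)
  define k where "k = coset_rep ?n a (int i + 1)"
  have k: "1 \<le> \<bar>k\<bar>" "\<bar>k\<bar> \<le> int ?n" using signed_perms_range[OF signed, of "int i + 1"] i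
    by (auto simp: k_def)
  have "act J (inv_into UNIV (coset_rep ?n a)) us ! i = signed_nth J us k"
    using i by (simp add: nth_act invinv k_def)
  also have "\<dots> = us ! (nat \<bar>k\<bar> - 1)"
    using k fixed by (auto simp: signed_nth_def)
  also have "\<bar>k\<bar> = \<bar>cycle_to \<bar>a\<bar> (int i + 1)\<bar>"
  proof -
    have "\<bar>coset_rep ?n a j\<bar> = \<bar>cycle_to \<bar>a\<bar> j\<bar>" for j
      by (simp add: coset_rep_def flip_ends_def cycle_to_odd)
    then show ?thesis by (simp only: k_def)
  qed
  also have "\<dots> = (if i = 0 then int ?p + 1 else if i \<le> ?p then int i else int i + 1)"
    using p by (auto simp: cycle_to_pos)
  finally have *: "act J (inv_into UNIV (coset_rep ?n a)) us ! i =
      us ! (nat (if i = 0 then int ?p + 1 else if i \<le> ?p then int i else int i + 1) - 1)" .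
  show "act J (inv_into UNIV (coset_rep ?n a)) us ! i = (us ! ?p # remove_nth ?p us) ! i"
    unfolding * using p(1) i
    by (cases i) (auto simp: remove_nth_def nth_append min_def nat_add_distrib)
qed

text \<open>The moment of the operators with indices \<open>1, \<dots>, k\<close> on the elementary tensor of the vectors with
  the indices \<open>is\<close>, in terms of the covariance \<open>c\<close>. The operator with the largest index acts first.\<close>

fun wick :: "(nat \<Rightarrow> nat \<Rightarrow> complex) \<Rightarrow> real \<Rightarrow> nat \<Rightarrow> nat list \<Rightarrow> complex" where
  "wick c q 0 is = (if is = [] then 1 else 0)"
| "wick c q (Suc k) is = wick c q k (Suc k # is) +
     (\<Sum>a\<in>coset_index (length is). complex_of_real (q ^ coset_length (length is) a) *
        (c (Suc k) (is ! (nat \<bar>a\<bar> - 1)) * wick c q k (remove_nth (nat \<bar>a\<bar> - 1) is)))"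

lemma fock_inner_vacuum_tensor:
  assumes "clinear J"
  shows "fock_inner J q vacuum (tensor us) = (if us = [] then 1 else 0)"
proof -
  have "D_group 0 = {id}" by (auto simp: D_group_words D_gens_def)
  moreover have "D_length 0 id = 0" using D_length_le[of "[]" 0] by simp
  ultimately show ?thesis
    by (simp add: vacuum_def fock_inner_tensor[OF assms] act_id tensor_inner_def)
qed

lemma remove_nth_map: "remove_nth p (map f xs) = map f (remove_nth p xs)"
  by (simp add: remove_nth_def take_map drop_map)

lemma set_remove_nth_subset: "set (remove_nth p xs) \<subseteq> set xs"
  using set_take_subset[of p xs] set_drop_subset[of "Suc p" xs] by (auto simp: remove_nth_def)

lemma moment_wick:
  assumes J: "selfadjoint_involution J"
    and fixed: "\<And>i. i \<in> {1..k} \<union> set is \<Longrightarrow> J (x i) = x i"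
  shows "moment J q x k (tensor (map x is)) = wick (\<lambda>i j. cinner (x i) (x j)) q k is"
  using fixed
proof (induction k arbitrary: "is")
  case 0
  have "clinear J" using J by (simp add: selfadjoint_involution_def)
  then show ?case by (simp add: moment_def fock_inner_vacuum_tensor)
next
  case (Suc k)
  have lin: "clinear J" using J by (simp add: selfadjoint_involution_def)
  note mlin = clinear_moment[OF J, of q x k]
  let ?n = "length is"
  have create: "moment J q x k (tensor (x (Suc k) # map x is)) =
      wick (\<lambda>i j. cinner (x i) (x j)) q k (Suc k # is)"
  proof -
    have "J (x i) = x i" if "i \<in> {1..k} \<union> set (Suc k # is)" for i
      using that Suc.prems by auto
    from Suc.IH[of "Suc k # is", OF this] show ?thesis by simp
  qed
  have "moment J q x k (coset_annihilation J q (x (Suc k)) (tensor (map x is))) =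
      (\<Sum>a\<in>coset_index ?n. complex_of_real (q ^ coset_length ?n a) * moment J q x k (contract (x (Suc k))
         (tensor (act J (inv_into UNIV (coset_rep ?n a)) (map x is)))))"
  proof -
    have "moment J q x k (\<Sum>a\<in>I. r a *\<^sub>C h a) = (\<Sum>a\<in>I. r a * moment J q x k (h a))"
      for I :: "int set" and r h
      by (induction I rule: infinite_finite_induct)
        (simp_all add: clinear_zero[OF mlin] clinear_add[OF mlin] clinear_scaleC[OF mlin]
          scaleC_complex_def)
    then show ?thesis by (simp only: coset_annihilation_tensor[OF lin] length_map)
  qed
  also have "\<dots> = (\<Sum>a\<in>coset_index ?n. complex_of_real (q ^ coset_length ?n a) *
        (cinner (x (Suc k)) (x (is ! (nat \<bar>a\<bar> - 1))) *
          wick (\<lambda>i j. cinner (x i) (x j)) q k (remove_nth (nat \<bar>a\<bar> - 1) is)))"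
  proof (rule sum.cong[OF refl])
    fix a assume a: "a \<in> coset_index ?n"
    let ?p = "nat \<bar>a\<bar> - 1"
    have p: "?p < ?n" using a by (auto simp: coset_index_def)
    have "act J (inv_into UNIV (coset_rep ?n a)) (map x is) = x (is ! ?p) # map x (remove_nth ?p is)"
      using act_inv_coset_rep_fixed[of a "map x is" J] a p Suc.prems by (auto simp: remove_nth_map)
    moreover have "moment J q x k (tensor (map x (remove_nth ?p is))) =
        wick (\<lambda>i j. cinner (x i) (x j)) q k (remove_nth ?p is)"
      using set_remove_nth_subset[of ?p "is"] Suc.prems by (intro Suc.IH) auto
    ultimately show "complex_of_real (q ^ coset_length ?n a) * moment J q x k (contract (x (Suc k))
         (tensor (act J (inv_into UNIV (coset_rep ?n a)) (map x is)))) =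
       complex_of_real (q ^ coset_length ?n a) * (cinner (x (Suc k)) (x (is ! ?p)) *
          wick (\<lambda>i j. cinner (x i) (x j)) q k (remove_nth ?p is))"
      by (simp only: contract_tensor_Cons clinear_scaleC[OF mlin] scaleC_complex_def)
  qed
  finally show ?case
    by (simp add: moment_Suc_coset[OF J] creation_tensor create)
qed

lemma tendsto_wick: "((\<lambda>q. wick c q k is) \<longlongrightarrow> wick c 1 k is) (at_left 1)"
proof (induction k arbitrary: "is")
  case (Suc k)
  show ?case
    unfolding wick.simps by (intro tendsto_intros Suc)
qed simp

section \<open>Outer components and uncovered pairs\<close>

definition uncovered :: "nat set set \<Rightarrow> nat set \<Rightarrow> bool" where
  "uncovered \<pi> b \<longleftrightarrow> \<not> (\<exists>d\<in>\<pi>. Min d < Min b \<and> Min b < Max d)"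

lemma pair_Min_Max:
  fixes b :: "nat set"
  assumes "card b = 2"
  shows "finite b" "b = {Min b, Max b}" "Min b < Max b"
proof -
  obtain i j where ij: "b = {i, j}" "i \<noteq> j" using assms by (auto simp: card_2_iff)
  then show "finite b" "b = {Min b, Max b}" "Min b < Max b" by (auto simp: min_def max_def)
qed

lemma crossing_pairs:
  assumes "card A = 2" "card B = 2"
  shows "crossing A B \<longleftrightarrow> Min A < Min B \<and> Min B < Max A \<and> Max A < Max B \<or>
     Min B < Min A \<and> Min A < Max B \<and> Max B < Max A"
proof -
  have *: "A = {a, b} \<and> a < b \<longleftrightarrow> a = Min A \<and> b = Max A" if "card A = 2" for A :: "nat set" and a b
    using pair_Min_Max[OF that] by (auto simp: min_def max_def)
  have "crossing A B \<longleftrightarrow> (\<exists>a b c d. (A = {a, b} \<and> a < b) \<and> (B = {c, d} \<and> c < d) \<and>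
     (a < c \<and> c < b \<and> b < d \<or> c < a \<and> a < d \<and> d < b))"
    unfolding crossing_def by blast
  then show ?thesis unfolding *[OF assms(1)] *[OF assms(2)] by simp
qed

text \<open>A property of a block spreads over its connected component if each crossing preserves it.\<close>

lemma crossing_equiv_induct:
  assumes rel: "(A, B) \<in> crossing_equiv \<pi>" and base: "P A"
    and step: "\<And>C D. C \<in> \<pi> \<Longrightarrow> D \<in> \<pi> \<Longrightarrow> crossing C D \<Longrightarrow> P C \<Longrightarrow> P D"
  shows "P B"
proof -
  have "(A, B) \<in> {(C, D). C \<in> \<pi> \<and> D \<in> \<pi> \<and> crossing C D}\<^sup>*"
    using rel by (simp add: crossing_equiv_def)
  then show ?thesis by (induction rule: rtrancl_induct) (use base step in auto)
qed

locale pairing =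
  fixes A :: "nat set" and \<pi> :: "nat set set"
  assumes fin: "finite A" and part: "partition_on A \<pi>" and pairs: "\<And>b. b \<in> \<pi> \<Longrightarrow> card b = 2"
begin

lemma finite_pairing: "finite \<pi>"
  using finite_elements[OF fin part] .

lemma block_eqI: "b \<in> \<pi> \<Longrightarrow> d \<in> \<pi> \<Longrightarrow> i \<in> b \<Longrightarrow> i \<in> d \<Longrightarrow> b = d"
  using part by (auto simp: partition_on_def disjoint_def)

lemma endpoints: "b \<in> \<pi> \<Longrightarrow> Min b \<in> b" "b \<in> \<pi> \<Longrightarrow> Max b \<in> b" "b \<in> \<pi> \<Longrightarrow> Min b < Max b"
  using pair_Min_Max[OF pairs] by blast+

lemma in_block: "b \<in> \<pi> \<Longrightarrow> i \<in> b \<Longrightarrow> i = Min b \<or> i = Max b"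
  using pair_Min_Max(2)[OF pairs] by blast

definition component :: "nat set \<Rightarrow> nat set" where
  "component b = \<Union> (crossing_equiv \<pi> `` {b})"

lemma components_eq: "components \<pi> = component ` \<pi>"
  by (auto simp: components_def quotient_def component_def)

lemma component_memE:
  assumes "b \<in> \<pi>" "i \<in> component b"
  obtains d where "d \<in> \<pi>" "(b, d) \<in> crossing_equiv \<pi>" "i \<in> d"
  using assms by (auto simp: component_def crossing_equiv_def)

lemma crossing_equiv_sym: "(b, d) \<in> crossing_equiv \<pi> \<Longrightarrow> (d, b) \<in> crossing_equiv \<pi>"
  using equiv_crossing_equiv[of \<pi>] by (meson equiv_def symD)

lemma crossing_equiv_trans:
  "(b, d) \<in> crossing_equiv \<pi> \<Longrightarrow> (d, e) \<in> crossing_equiv \<pi> \<Longrightarrow> (b, e) \<in> crossing_equiv \<pi>"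
  using equiv_crossing_equiv[of \<pi>] by (meson equiv_def transD)

lemma component_self: "b \<in> \<pi> \<Longrightarrow> b \<subseteq> component b"
  using equiv_crossing_equiv[of \<pi>] by (auto simp: component_def crossing_equiv_def)

lemma component_cong: "(b, d) \<in> crossing_equiv \<pi> \<Longrightarrow> component b = component d"
  unfolding component_def using equiv_class_eq[OF equiv_crossing_equiv] by metis

lemma finite_component: "b \<in> \<pi> \<Longrightarrow> finite (component b)"
  unfolding component_def using finite_pairing pair_Min_Max(1)[OF pairs]
  by (auto simp: crossing_equiv_def intro!: finite_Union elim!: rev_finite_subset)

text \<open>A block that reaches to the left of \<open>Min b\<close> and crosses a block that does not would have
  \<open>Min b\<close> strictly inside.\<close>

lemma Min_component_uncovered:
  assumes b: "b \<in> \<pi>" and unc: "uncovered \<pi> b" and i: "i \<in> component b"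
  shows "Min b \<le> i"
proof -
  obtain d where d: "d \<in> \<pi>" "(b, d) \<in> crossing_equiv \<pi>" "i \<in> d" using component_memE b i by metis
  have "Min b \<le> Min d"
    using d(2)
  proof (rule crossing_equiv_induct)
    fix C D assume CD: "C \<in> \<pi>" "D \<in> \<pi>" "crossing C D" "Min b \<le> Min C"
    then have "Min C < Max D" using endpoints by (fastforce simp: crossing_pairs pairs)
    then show "Min b \<le> Min D" using unc CD by (auto simp: uncovered_def not_less)
  qed simp
  moreover have "Min d \<le> i" using d pair_Min_Max(1)[OF pairs] by simp
  ultimately show ?thesis by simp
qed

text \<open>In another component no block contains or encloses \<open>Min b\<close>, so each of its blocks lies on one side
  of \<open>Min b\<close>. Crossing blocks lie on the same side, hence so does the whole component.\<close>

lemma not_covered_component: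
  assumes b: "b \<in> \<pi>" and unc: "uncovered \<pi> b" and D: "D \<in> components \<pi>" "D \<noteq> component b"
  shows "\<not> covers D (component b)"
proof
  assume "covers D (component b)"
  then obtain i j where ij: "i \<in> D" "j \<in> D" "i < Min b" "Min b < j"
    using component_self[OF b] endpoints[OF b] by (auto simp: covers_def)
  obtain d where d: "d \<in> \<pi>" "D = component d" using D(1) by (auto simp: components_eq)
  obtain e where e: "e \<in> \<pi>" "(d, e) \<in> crossing_equiv \<pi>" "i \<in> e" using component_memE d ij(1) by metis
  obtain f where f: "f \<in> \<pi>" "(d, f) \<in> crossing_equiv \<pi>" "j \<in> f" using component_memE d ij(2) by metis
  have notin: "Min b \<notin> c" if "c \<in> \<pi>" "(d, c) \<in> crossing_equiv \<pi>" for c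
    using that D(2) d b block_eqI[OF that(1) b] endpoints(1)[OF b] component_cong by metis
  have low: "Max c < Min b" if "c \<in> \<pi>" "(d, c) \<in> crossing_equiv \<pi>" "Min c < Min b" for c
    using unc that(1,3) notin[OF that(1,2)] endpoints(2)[OF that(1)]
    by (metis linorder_neqE_nat uncovered_def)
  have "(d, f) \<in> crossing_equiv \<pi> \<and> Max f < Min b"
    using crossing_equiv_trans[OF crossing_equiv_sym[OF e(2)] f(2)]
  proof (rule crossing_equiv_induct)
    have "Min e < Min b"
      using in_block[OF e(1,3)] endpoints(3)[OF e(1)] ij(3) by auto
    then show "(d, e) \<in> crossing_equiv \<pi> \<and> Max e < Min b" using low[OF e(1,2)] e(2) by blast
    fix C E assume CE: "C \<in> \<pi>" "E \<in> \<pi>" "crossing C E" "(d, C) \<in> crossing_equiv \<pi> \<and> Max C < Min b"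
    then have "(C, E) \<in> crossing_equiv \<pi>" by (auto simp: crossing_equiv_def)
    then have dE: "(d, E) \<in> crossing_equiv \<pi>" using CE(4) crossing_equiv_trans by blast
    moreover have "Min E < Max C"
      using CE endpoints by (fastforce simp: crossing_pairs pairs)
    ultimately show "(d, E) \<in> crossing_equiv \<pi> \<and> Max E < Min b" using low[OF CE(2)] CE(4) by simp
  qed
  then show False using f(1,3) ij(4) in_block[OF f(1,3)] endpoints(3)[OF f(1)] by auto
qed

text \<open>A block \<open>d\<close> that has the minimum of a component strictly inside belongs to another component. No
  block of the first component crosses \<open>d\<close>, so all of them stay inside \<open>d\<close>, and the component of
  \<open>d\<close> covers them.\<close>

lemma outer_Min_uncovered:
  assumes b: "b \<in> \<pi>" and min: "\<And>i. i \<in> component b \<Longrightarrow> Min b \<le> i"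
    and outer: "\<And>D. D \<in> components \<pi> \<Longrightarrow> D \<noteq> component b \<Longrightarrow> \<not> covers D (component b)"
  shows "uncovered \<pi> b"
  unfolding uncovered_def
proof
  assume "\<exists>d\<in>\<pi>. Min d < Min b \<and> Min b < Max d"
  then obtain d where d: "d \<in> \<pi>" "Min d < Min b" "Min b < Max d" by blast
  have neq: "component d \<noteq> component b"
    using min[of "Min d"] component_self[OF d(1)] endpoints(1)[OF d(1)] d(2) by force
  have inside: "Min d < i \<and> i < Max d" if i: "i \<in> component b" for i
  proof -
    obtain e where e: "e \<in> \<pi>" "(b, e) \<in> crossing_equiv \<pi>" "i \<in> e" using component_memE b i by metis
    have noncross: "\<not> crossing d c" "c \<noteq> d" if "c \<in> \<pi>" "(b, c) \<in> crossing_equiv \<pi>" for c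
    proof -
      show "c \<noteq> d" using that component_cong neq by metis
      show "\<not> crossing d c"
      proof
        assume "crossing d c"
        then have "(d, c) \<in> crossing_equiv \<pi>" using that d(1) by (auto simp: crossing_equiv_def)
        then show False using that component_cong neq by metis
      qed
    qed
    have sub: "Max c < Max d"
      if "c \<in> \<pi>" "(b, c) \<in> crossing_equiv \<pi>" "Min d < Min c" "Min c < Max d" for c
    proof -
      have "Max c \<noteq> Max d" using noncross[OF that(1,2)] that(1) d(1) block_eqI endpoints by metis
      then show ?thesis
        using noncross[OF that(1,2)] that(1,3,4) d(1) by (auto simp: crossing_pairs pairs)
    qed
    have "(b, e) \<in> crossing_equiv \<pi> \<and> Min d < Min e \<and> Max e < Max d"
      using e(2)
    proof (rule crossing_equiv_induct)
      have bb: "(b, b) \<in> crossing_equiv \<pi>" using b by (simp add: crossing_equiv_def)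
      then show "(b, b) \<in> crossing_equiv \<pi> \<and> Min d < Min b \<and> Max b < Max d"
        using sub[OF b bb] d by blast
      fix C E assume CE: "C \<in> \<pi>" "E \<in> \<pi>" "crossing C E"
        "(b, C) \<in> crossing_equiv \<pi> \<and> Min d < Min C \<and> Max C < Max d"
      then have "(C, E) \<in> crossing_equiv \<pi>" by (auto simp: crossing_equiv_def)
      then have bE: "(b, E) \<in> crossing_equiv \<pi>" using CE(4) crossing_equiv_trans by blast
      have "Min E \<in> component b" using bE endpoints(1)[OF CE(2)] by (auto simp: component_def)
      then have "Min d < Min E" using min d(2) by fastforce
      moreover have "Min E < Max d"
        using CE endpoints by (fastforce simp: crossing_pairs pairs)
      ultimately show "(b, E) \<in> crossing_equiv \<pi> \<and> Min d < Min E \<and> Max E < Max d"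
        using bE sub[OF CE(2) bE] by blast
    qed
    then show ?thesis using in_block[OF e(1,3)] endpoints(3)[OF e(1)] by auto
  qed
  have "covers (component d) (component b)"
    unfolding covers_def
    using inside component_self[OF d(1)] endpoints[OF d(1)] by blast
  then show False using outer[of "component d"] neq d(1) by (auto simp: components_eq)
qed

lemma n_outer_eq_card_uncovered: "n_outer \<pi> = card {b \<in> \<pi>. uncovered \<pi> b}"
proof -
  let ?U = "{b \<in> \<pi>. uncovered \<pi> b}"
  let ?O = "{C \<in> components \<pi>. \<not> (\<exists>D\<in>components \<pi>. D \<noteq> C \<and> covers D C)}"
  have Min_comp: "Min (component b) = Min b" if "b \<in> ?U" for b
  proof (rule Min_eqI)
    show "finite (component b)" using that finite_component by simp
    show "Min b \<in> component b" using that component_self endpoints(1) by blast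
    show "\<And>i. i \<in> component b \<Longrightarrow> Min b \<le> i" using that Min_component_uncovered by simp
  qed
  have "bij_betw component ?U ?O"
  proof (rule bij_betw_imageI)
    show "inj_on component ?U"
    proof (rule inj_onI)
      fix b d assume bd: "b \<in> ?U" "d \<in> ?U" "component b = component d"
      then have "Min b = Min d" using Min_comp by metis
      then show "b = d" using bd block_eqI endpoints(1) by (metis mem_Collect_eq)
    qed
    show "component ` ?U = ?O"
    proof (intro subset_antisym subsetI)
      fix C assume "C \<in> component ` ?U"
      then show "C \<in> ?O" using not_covered_component by (auto simp: components_eq)
    next
      fix C assume C: "C \<in> ?O"
      then obtain b where b: "b \<in> \<pi>" "C = component b" by (auto simp: components_eq)
      have "C \<noteq> {}" using component_self[OF b(1)] endpoints(1)[OF b(1)] b(2) by blast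
      then have "Min C \<in> component b" using finite_component[OF b(1)] b(2) by simp
      then obtain d where d: "d \<in> \<pi>" "(b, d) \<in> crossing_equiv \<pi>" "Min C \<in> d"
        using component_memE b(1) by metis
      have Cd: "C = component d" using component_cong[OF d(2)] b(2) by simp
      have "Min d \<in> C" using component_self[OF d(1)] endpoints(1)[OF d(1)] Cd by blast
      then have "Min C \<le> Min d" using finite_component[OF d(1)] Cd by simp
      then have eq: "Min d = Min C" using d(3) in_block[OF d(1,3)] endpoints(3)[OF d(1)] by auto
      have "uncovered \<pi> d"
      proof (rule outer_Min_uncovered[OF d(1)])
        show "\<And>i. i \<in> component d \<Longrightarrow> Min d \<le> i"
          using eq finite_component[OF d(1)] Cd by simp
        show "\<And>D. D \<in> components \<pi> \<Longrightarrow> D \<noteq> component d \<Longrightarrow> \<not> covers D (component d)"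
          using C Cd by blast
      qed
      then show "C \<in> component ` ?U" using d(1) Cd by blast
    qed
  qed
  then show ?thesis by (simp add: n_outer_def bij_betw_same_card)
qed

end

section \<open>Pairings with open points\<close>

text \<open>The points of \<open>S\<close> are meant to lie above \<open>k\<close> and stand for the factors of the current tensor. They can only be annihilated by one of the operators \<open>1, \<dots>, k\<close>, so no pair lies inside \<open>S\<close>.\<close>

definition partial_pairings :: "nat \<Rightarrow> nat set \<Rightarrow> nat set set set" where
  "partial_pairings k S = {\<pi>. partition_on ({1..k} \<union> S) \<pi> \<and> (\<forall>b\<in>\<pi>. card b = 2 \<and> Min b \<le> k)}"

definition pairing_weight :: "(nat \<Rightarrow> nat \<Rightarrow> complex) \<Rightarrow> nat set set \<Rightarrow> complex" where
  "pairing_weight c \<pi> = (\<Prod>b\<in>\<pi>. (if uncovered \<pi> b then 1 else 2) * c (Min b) (Max b))"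

lemma finite_partial_pairings:
  assumes "finite S"
  shows "finite (partial_pairings k S)"
  by (rule finite_subset[of _ "{\<pi>. partition_on ({1..k} \<union> S) \<pi>}"])
    (use assms in \<open>auto simp: partial_pairings_def intro!: finitely_many_partition_on\<close>)

lemma partial_pairingsD:
  assumes "\<pi> \<in> partial_pairings k S"
  shows "\<Union>\<pi> = {1..k} \<union> S" "b \<in> \<pi> \<Longrightarrow> card b = 2" "b \<in> \<pi> \<Longrightarrow> Min b \<le> k"
    and "b \<in> \<pi> \<Longrightarrow> d \<in> \<pi> \<Longrightarrow> i \<in> b \<Longrightarrow> i \<in> d \<Longrightarrow> b = d"
proof -
  have part: "partition_on ({1..k} \<union> S) \<pi>" using assms by (simp add: partial_pairings_def)
  then show "\<Union>\<pi> = {1..k} \<union> S" by (simp add: partition_on_def)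
  show "b \<in> \<pi> \<Longrightarrow> card b = 2" "b \<in> \<pi> \<Longrightarrow> Min b \<le> k"
    using assms by (simp_all add: partial_pairings_def)
  show "b \<in> \<pi> \<Longrightarrow> d \<in> \<pi> \<Longrightarrow> i \<in> b \<Longrightarrow> i \<in> d \<Longrightarrow> b = d"
    using partition_onD2[OF part] by (auto dest: disjointD)
qed

lemma finite_partial_pairing: "finite S \<Longrightarrow> \<pi> \<in> partial_pairings k S \<Longrightarrow> finite \<pi>"
  by (auto simp: partial_pairings_def intro: finite_elements[rotated])

lemma insert_pair_partial_pairing:
  assumes S: "\<And>s. s \<in> S \<Longrightarrow> Suc k < s" and s: "s \<in> S" and \<pi>: "\<pi> \<in> partial_pairings k (S - {s})"
  shows "insert {Suc k, s} \<pi> \<in> partial_pairings (Suc k) S" "{Suc k, s} \<notin> \<pi>"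
proof -
  have un: "\<Union>\<pi> = {1..k} \<union> (S - {s})" using partial_pairingsD(1)[OF \<pi>] .
  have notin: "Suc k \<notin> \<Union>\<pi>" "s \<notin> \<Union>\<pi>" unfolding un using S[OF s] S by auto
  then show "{Suc k, s} \<notin> \<pi>" by auto
  have "{1..Suc k} \<union> S - {Suc k, s} = {1..k} \<union> (S - {s})" using S S[OF s] by auto
  then have "partition_on ({1..Suc k} \<union> S) (insert {Suc k, s} \<pi>)"
    using partition_on_insert[of "{Suc k, s}" \<pi> "{1..Suc k} \<union> S"] notin s \<pi>
    by (auto simp: partial_pairings_def disjnt_iff)
  moreover have "card b = 2 \<and> Min b \<le> Suc k" if "b \<in> insert {Suc k, s} \<pi>" for b
    using that partial_pairingsD(2,3)[OF \<pi>, of b] S[OF s] by fastforce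
  ultimately show "insert {Suc k, s} \<pi> \<in> partial_pairings (Suc k) S"
    by (simp add: partial_pairings_def)
qed

text \<open>The pair \<open>{k + 1, s}\<close> is uncovered exactly if no other point of \<open>S\<close> is left, since any such point
  is paired with a point of \<open>{1..k}\<close>. Its smaller point exceeds all other minima, so it covers none
  of them.\<close>

lemma pairing_weight_insert:
  assumes fin: "finite S" and S: "\<And>s. s \<in> S \<Longrightarrow> Suc k < s" and s: "s \<in> S"
    and \<pi>: "\<pi> \<in> partial_pairings k (S - {s})"
  shows "pairing_weight c (insert {Suc k, s} \<pi>) =
    (if S = {s} then 1 else 2) * c (Suc k) s * pairing_weight c \<pi>"
proof -
  let ?b = "{Suc k, s}" and ?\<pi> = "insert {Suc k, s} \<pi>"
  have ks: "Suc k < s" by (rule S[OF s])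
  then have Mb: "Min ?b = Suc k" "Max ?b = s" by (auto simp: min_def max_def)
  have old: "uncovered ?\<pi> d \<longleftrightarrow> uncovered \<pi> d" if "d \<in> \<pi>" for d
    using partial_pairingsD(3)[OF \<pi> that] by (auto simp: uncovered_def Mb)
  have new: "uncovered ?\<pi> ?b \<longleftrightarrow> S = {s}"
  proof
    assume unc: "uncovered ?\<pi> ?b"
    have False if t: "t \<in> S" "t \<noteq> s" for t
    proof -
      have "t \<in> \<Union>\<pi>" unfolding partial_pairingsD(1)[OF \<pi>] using t by simp
      then obtain d where d: "d \<in> \<pi>" "t \<in> d" by blast
      have "t \<le> Max d" using d pair_Min_Max(1)[OF partial_pairingsD(2)[OF \<pi>]] by simp
      moreover have "Suc k < t" using S t by simp
      moreover have "Min d \<le> k" using partial_pairingsD(3)[OF \<pi> d(1)] .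
      ultimately show False using unc d(1) by (auto simp: uncovered_def Mb)
    qed
    then show "S = {s}" using s by blast
  next
    assume S1: "S = {s}"
    have "Max d \<le> k" if d: "d \<in> \<pi>" for d
    proof -
      have "Max d \<in> d" using pair_Min_Max[OF partial_pairingsD(2)[OF \<pi> d]] by blast
      then have "Max d \<in> \<Union>\<pi>" using d by blast
      then show ?thesis unfolding partial_pairingsD(1)[OF \<pi>] using S1 by simp
    qed
    then show "uncovered ?\<pi> ?b" using ks by (fastforce simp: uncovered_def Mb)
  qed
  have fin\<pi>: "finite \<pi>" using finite_partial_pairing[OF _ \<pi>] fin by simp
  have "pairing_weight c ?\<pi> = (if uncovered ?\<pi> ?b then 1 else 2) * c (Min ?b) (Max ?b) *
      (\<Prod>d\<in>\<pi>. (if uncovered ?\<pi> d then 1 else 2) * c (Min d) (Max d))"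
    unfolding pairing_weight_def
    using fin\<pi> insert_pair_partial_pairing(2)[OF S s \<pi>] by (subst prod.insert) auto
  also have "(\<Prod>d\<in>\<pi>. (if uncovered ?\<pi> d then 1 else 2) * c (Min d) (Max d)) = pairing_weight c \<pi>"
    unfolding pairing_weight_def by (rule prod.cong) (simp_all add: old)
  finally show ?thesis by (simp only: new Mb)
qed

text \<open>The two cases are those of the operator \<open>k + 1\<close>: if its partner is at most \<open>k\<close> then it creates a
  new open point, otherwise it annihilates the open point \<open>s\<close>.\<close>

lemma partial_pairings_Suc:
  assumes S: "\<And>s. s \<in> S \<Longrightarrow> Suc k < s"
  shows "partial_pairings (Suc k) S = partial_pairings k (insert (Suc k) S) \<union>
    (\<Union>s\<in>S. insert {Suc k, s} ` partial_pairings k (S - {s}))"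
proof (intro subset_antisym subsetI)
  fix \<pi> assume \<pi>: "\<pi> \<in> partial_pairings (Suc k) S"
  note D = partial_pairingsD[OF \<pi>]
  have "Suc k \<in> \<Union>\<pi>" using D(1) by simp
  then obtain b where b: "b \<in> \<pi>" "Suc k \<in> b" by blast
  note pb = pair_Min_Max[OF D(2)[OF b(1)]]
  show "\<pi> \<in> partial_pairings k (insert (Suc k) S) \<union>
    (\<Union>s\<in>S. insert {Suc k, s} ` partial_pairings k (S - {s}))"
  proof (cases "Min b = Suc k")
    case False
    have "Min d \<le> k" if d: "d \<in> \<pi>" for d
    proof (rule ccontr)
      assume "\<not> Min d \<le> k"
      then have "Min d = Suc k" using D(3)[OF d] by simp
      moreover have "Min d \<in> d" using pair_Min_Max[OF D(2)[OF d]] by blast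
      ultimately have "d = b" using D(4)[OF d b(1) _ b(2)] by simp
      then show False using False \<open>Min d = Suc k\<close> by simp
    qed
    moreover have "{1..Suc k} \<union> S = {1..k} \<union> insert (Suc k) S" by auto
    ultimately have "\<pi> \<in> partial_pairings k (insert (Suc k) S)"
      using \<pi> by (simp add: partial_pairings_def)
    then show ?thesis by blast
  next
    case True
    define s where "s = Max b"
    have bs: "b = {Suc k, s}" "Suc k < s" using pb True by (simp_all add: s_def)
    have "s \<in> \<Union>\<pi>" using b(1) bs by blast
    then have s: "s \<in> S" unfolding D(1) using bs(2) by simp
    define \<rho> where "\<rho> = \<pi> - {b}"
    have "disjnt b (\<Union>\<rho>)" using D(4)[OF b(1)] by (auto simp: disjnt_iff \<rho>_def)
    then have "partition_on ({1..Suc k} \<union> S - b) \<rho>"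
      using partition_on_insert[of b \<rho> "{1..Suc k} \<union> S"] \<pi> b(1)
      by (simp add: \<rho>_def insert_absorb partial_pairings_def)
    moreover have "{1..Suc k} \<union> S - b = {1..k} \<union> (S - {s})" using S bs by auto
    moreover have "Min d \<le> k" if d: "d \<in> \<rho>" for d
    proof -
      have d': "d \<in> \<pi>" "d \<noteq> b" using d by (auto simp: \<rho>_def)
      have "Min d \<in> d" using pair_Min_Max[OF D(2)[OF d'(1)]] by blast
      then have "Min d \<noteq> Suc k" using D(4)[OF d'(1) b(1) _ b(2)] d'(2) by metis
      then show ?thesis using D(3)[OF d'(1)] by simp
    qed
    ultimately have "\<rho> \<in> partial_pairings k (S - {s})"
      using D(2) by (auto simp: partial_pairings_def \<rho>_def)
    moreover have "\<pi> = insert {Suc k, s} \<rho>" using b(1) bs(1) by (auto simp: \<rho>_def)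
    ultimately show ?thesis using s by blast
  qed
next
  fix \<pi> assume "\<pi> \<in> partial_pairings k (insert (Suc k) S) \<union>
    (\<Union>s\<in>S. insert {Suc k, s} ` partial_pairings k (S - {s}))"
  then show "\<pi> \<in> partial_pairings (Suc k) S"
  proof
    assume \<pi>: "\<pi> \<in> partial_pairings k (insert (Suc k) S)"
    have "{1..Suc k} \<union> S = {1..k} \<union> insert (Suc k) S" by auto
    with \<pi> show ?thesis by (auto simp: partial_pairings_def)
  next
    assume "\<pi> \<in> (\<Union>s\<in>S. insert {Suc k, s} ` partial_pairings k (S - {s}))"
    then show ?thesis using insert_pair_partial_pairing(1)[OF S] by auto
  qed
qed

lemma sum_pairing_weight_Suc:
  assumes fin: "finite S" and S: "\<And>s. s \<in> S \<Longrightarrow> Suc k < s"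
  shows "(\<Sum>\<pi>\<in>partial_pairings (Suc k) S. pairing_weight c \<pi>) =
    (\<Sum>\<pi>\<in>partial_pairings k (insert (Suc k) S). pairing_weight c \<pi>) +
    (\<Sum>s\<in>S. (if S = {s} then 1 else 2) * (c (Suc k) s *
       (\<Sum>\<pi>\<in>partial_pairings k (S - {s}). pairing_weight c \<pi>)))"
proof -
  let ?I = "\<lambda>s. insert {Suc k, s} ` partial_pairings k (S - {s})"
  have mem: "{Suc k, s} \<in> \<pi>" if "\<pi> \<in> ?I s" for \<pi> s using that by auto
  have disj1: "partial_pairings k (insert (Suc k) S) \<inter> (\<Union>s\<in>S. ?I s) = {}"
  proof -
    have False if \<pi>: "\<pi> \<in> partial_pairings k (insert (Suc k) S)" and s: "s \<in> S" "\<pi> \<in> ?I s" for \<pi> s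
      using partial_pairingsD(3)[OF \<pi> mem[OF s(2)]] S[OF s(1)] by simp
    then show ?thesis by blast
  qed
  have disj2: "?I s \<inter> ?I t = {}" if "s \<in> S" "t \<in> S" "s \<noteq> t" for s t
  proof -
    have False if \<pi>: "\<pi> \<in> ?I s" "\<pi> \<in> ?I t" for \<pi>
    proof -
      have "\<pi> \<in> partial_pairings (Suc k) S"
        using \<pi>(1) insert_pair_partial_pairing(1)[OF S \<open>s \<in> S\<close>] by auto
      from partial_pairingsD(4)[OF this mem[OF \<pi>(1)] mem[OF \<pi>(2)], of "Suc k"]
      show False using \<open>s \<noteq> t\<close> by (auto simp: doubleton_eq_iff)
    qed
    then show ?thesis by blast
  qed
  have split: "partial_pairings (Suc k) S = partial_pairings k (insert (Suc k) S) \<union> (\<Union>s\<in>S. ?I s)"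
    by (rule partial_pairings_Suc) (rule S)
  have inj: "inj_on (insert {Suc k, s}) (partial_pairings k (S - {s}))" if "s \<in> S" for s
    using insert_pair_partial_pairing(2)[OF S that] by (intro inj_onI) (metis insert_ident)
  have "(\<Sum>\<pi>\<in>partial_pairings (Suc k) S. pairing_weight c \<pi>) =
    (\<Sum>\<pi>\<in>partial_pairings k (insert (Suc k) S). pairing_weight c \<pi>) +
    (\<Sum>\<pi>\<in>(\<Union>s\<in>S. ?I s). pairing_weight c \<pi>)"
    unfolding split
    by (rule sum.union_disjoint) (use fin disj1 in \<open>auto intro: finite_partial_pairings\<close>)
  also have "(\<Sum>\<pi>\<in>(\<Union>s\<in>S. ?I s). pairing_weight c \<pi>) = (\<Sum>s\<in>S. \<Sum>\<pi>\<in>?I s. pairing_weight c \<pi>)"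
    by (rule sum.UNION_disjoint) (use fin disj2 in \<open>auto intro: finite_partial_pairings\<close>)
  also have "\<dots> = (\<Sum>s\<in>S. (if S = {s} then 1 else 2) * (c (Suc k) s *
       (\<Sum>\<pi>\<in>partial_pairings k (S - {s}). pairing_weight c \<pi>)))"
  proof (rule sum.cong[OF refl])
    fix s assume s: "s \<in> S"
    show "(\<Sum>\<pi>\<in>?I s. pairing_weight c \<pi>) = (if S = {s} then 1 else 2) * (c (Suc k) s *
       (\<Sum>\<pi>\<in>partial_pairings k (S - {s}). pairing_weight c \<pi>))"
      unfolding sum.reindex[OF inj[OF s]] comp_def sum_distrib_left
      by (rule sum.cong[OF refl]) (simp only: pairing_weight_insert[OF fin S s] mult.assoc)
  qed
  finally show ?thesis .
qed

lemma partial_pairings_0: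
  assumes "\<And>s. s \<in> S \<Longrightarrow> 0 < s"
  shows "partial_pairings 0 S = (if S = {} then {{}} else {})"
proof -
  have "\<pi> = {}" if \<pi>: "\<pi> \<in> partial_pairings 0 S" for \<pi>
  proof (rule ccontr)
    assume "\<pi> \<noteq> {}"
    then obtain b where b: "b \<in> \<pi>" by blast
    have "Min b \<in> b" using pair_Min_Max[OF partial_pairingsD(2)[OF \<pi> b]] by blast
    then have "Min b \<in> \<Union>\<pi>" using b by blast
    then have "0 < Min b" unfolding partial_pairingsD(1)[OF \<pi>] using assms by auto
    then show False using partial_pairingsD(3)[OF \<pi> b] by simp
  qed
  then have "partial_pairings 0 S \<subseteq> {{}}" by blast
  moreover have "{} \<in> partial_pairings 0 S \<longleftrightarrow> S = {}"
    by (auto simp: partial_pairings_def partition_on_def)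
  ultimately show ?thesis by auto
qed

lemma partial_pairings_full: "partial_pairings k {} = pair_partitions k"
proof -
  have "Min b \<le> k" if "partition_on {1..k} \<pi>" "b \<in> \<pi>" "card b = 2" for \<pi> b
    using pair_Min_Max[OF that(3)] that(1,2) by (metis Union_upper atLeastAtMost_iff insertI1 partition_onD1 subset_iff)
  then show ?thesis by (auto simp: partial_pairings_def pair_partitions_def)
qed

lemma pairing_weight_eq:
  assumes \<pi>: "\<pi> \<in> pair_partitions (2 * m)"
  shows "pairing_weight c \<pi> = 2 ^ (m - n_outer \<pi>) * (\<Prod>b\<in>\<pi>. c (Min b) (Max b))"
proof -
  interpret pairing "{1..2 * m}" \<pi>
    by standard (use \<pi> in \<open>auto simp: pair_partitions_def\<close>)
  have "card (\<Union>\<pi>) = (\<Sum>b\<in>\<pi>. card b)"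
    using part pair_Min_Max(1)[OF pairs]
    by (intro card_Union_disjoint) (auto simp: partition_on_def disjoint_def pairwise_def disjnt_def)
  then have "card \<pi> = m" using part pairs by (simp add: partition_on_def)
  moreover have "{b \<in> \<pi>. \<not> uncovered \<pi> b} = \<pi> - {b \<in> \<pi>. uncovered \<pi> b}" by auto
  ultimately have "card {b \<in> \<pi>. \<not> uncovered \<pi> b} = m - n_outer \<pi>"
    using finite_pairing by (simp add: card_Diff_subset n_outer_eq_card_uncovered)
  moreover have "(\<Prod>b\<in>\<pi>. if uncovered \<pi> b then 1 else 2) = (2 :: complex) ^ card {b \<in> \<pi>. \<not> uncovered \<pi> b}"
    using finite_pairing by (simp add: prod.If_cases Int_def)
  ultimately show ?thesis by (simp add: pairing_weight_def prod.distrib)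
qed

section \<open>The limit\<close>

text \<open>Each position is the absolute value of two coset indices, except in the trivial group \<open>D(1)\<close>.\<close>

lemma sum_coset_index:
  fixes f :: "nat \<Rightarrow> complex"
  shows "(\<Sum>a\<in>coset_index n. f (nat \<bar>a\<bar> - 1)) = (if n = 1 then 1 else 2) * (\<Sum>p<n. f p)"
proof (cases "n = 1")
  case True
  then have "coset_index n = {1}" by (auto simp: coset_index_def)
  then show ?thesis using True by simp
next
  case False
  have split: "coset_index n = {1..int n} \<union> {- int n..-1}"
    using False by (auto simp: coset_index_def)
  have "(\<Sum>a\<in>{1..int n}. f (nat \<bar>a\<bar> - 1)) = (\<Sum>p<n. f p)"
    by (rule sum.reindex_bij_witness[of _ "\<lambda>p. int p + 1" "\<lambda>a. nat a - 1"]) auto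
  moreover have "(\<Sum>a\<in>{- int n..-1}. f (nat \<bar>a\<bar> - 1)) = (\<Sum>p<n. f p)"
    by (rule sum.reindex_bij_witness[of _ "\<lambda>p. - (int p + 1)" "\<lambda>a. nat (- a) - 1"]) auto
  moreover have "(\<Sum>a\<in>coset_index n. f (nat \<bar>a\<bar> - 1)) =
      (\<Sum>a\<in>{1..int n}. f (nat \<bar>a\<bar> - 1)) + (\<Sum>a\<in>{- int n..-1}. f (nat \<bar>a\<bar> - 1))"
    unfolding split by (rule sum.union_disjoint) auto
  ultimately show ?thesis using False by simp
qed

lemma remove_nth_distinct:
  assumes "distinct xs" "p < length xs"
  shows "distinct (remove_nth p xs)" "set (remove_nth p xs) = set xs - {xs ! p}"
proof -
  have "xs = take p xs @ xs ! p # drop (Suc p) xs" using assms(2) by (rule id_take_nth_drop)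
  then have "distinct (take p xs @ xs ! p # drop (Suc p) xs)"
    "set xs = set (take p xs @ xs ! p # drop (Suc p) xs)" using assms(1) by metis+
  then show "distinct (remove_nth p xs)" "set (remove_nth p xs) = set xs - {xs ! p}"
    by (auto simp: remove_nth_def)
qed

text \<open>At \<open>q = 1\<close> the recursion for moments and the recursion \<open>sum_pairing_weight_Suc\<close> for weighted
  pairings coincide: the list has length \<open>1\<close> exactly if the chosen open point is the only one.\<close>

lemma wick_eq_sum_pairings:
  assumes "distinct is" "\<And>i. i \<in> set is \<Longrightarrow> k < i"
  shows "wick c 1 k is = (\<Sum>\<pi>\<in>partial_pairings k (set is). pairing_weight c \<pi>)"
  using assms
proof (induction k arbitrary: "is")
  case 0
  then show ?case using partial_pairings_0[of "set is"] by (simp add: pairing_weight_def)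
next
  case (Suc k)
  let ?S = "set is" and ?n = "length is"
  let ?W = "\<lambda>S. \<Sum>\<pi>\<in>partial_pairings k S. pairing_weight c \<pi>"
  have singleton: "?n = 1 \<longleftrightarrow> ?S = {s}" if "s \<in> ?S" for s
    using that distinct_card[OF Suc.prems(1)] by (auto simp: card_1_singleton_iff)
  have "(\<Sum>a\<in>coset_index ?n. complex_of_real (1 ^ coset_length ?n a) *
      (c (Suc k) (is ! (nat \<bar>a\<bar> - 1)) * wick c 1 k (remove_nth (nat \<bar>a\<bar> - 1) is))) =
    (if ?n = 1 then 1 else 2) * (\<Sum>p<?n. c (Suc k) (is ! p) * wick c 1 k (remove_nth p is))"
    using sum_coset_index[of "\<lambda>p. c (Suc k) (is ! p) * wick c 1 k (remove_nth p is)" ?n] by simp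
  also have "(\<Sum>p<?n. c (Suc k) (is ! p) * wick c 1 k (remove_nth p is)) =
      (\<Sum>p<?n. c (Suc k) (is ! p) * ?W (?S - {is ! p}))"
  proof (rule sum.cong[OF refl])
    fix p assume "p \<in> {..<?n}"
    then have p: "p < ?n" by simp
    note rem = remove_nth_distinct[OF Suc.prems(1) p]
    have "wick c 1 k (remove_nth p is) = ?W (set (remove_nth p is))"
      by (rule Suc.IH[OF rem(1)]) (use Suc.prems(2) in \<open>auto simp: rem(2) Suc_lessD\<close>)
    then show "c (Suc k) (is ! p) * wick c 1 k (remove_nth p is) = c (Suc k) (is ! p) * ?W (?S - {is ! p})"
      by (simp add: rem(2))
  qed
  also have "\<dots> = (\<Sum>s\<in>?S. c (Suc k) s * ?W (?S - {s}))"
    using sum.reindex_bij_betw[OF bij_betw_nth[OF Suc.prems(1) refl refl]] by simp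
  also have "(if ?n = 1 then 1 else 2) * \<dots> = (\<Sum>s\<in>?S. (if ?S = {s} then 1 else 2) * (c (Suc k) s * ?W (?S - {s})))"
    unfolding sum_distrib_left by (rule sum.cong[OF refl]) (simp only: singleton)
  finally have annihilate: "(\<Sum>a\<in>coset_index ?n. complex_of_real (1 ^ coset_length ?n a) *
      (c (Suc k) (is ! (nat \<bar>a\<bar> - 1)) * wick c 1 k (remove_nth (nat \<bar>a\<bar> - 1) is))) =
    (\<Sum>s\<in>?S. (if ?S = {s} then 1 else 2) * (c (Suc k) s * ?W (?S - {s})))" .
  have "wick c 1 k (Suc k # is) = ?W (insert (Suc k) ?S)"
    using Suc.IH[of "Suc k # is"] Suc.prems by fastforce
  moreover have "(\<Sum>\<pi>\<in>partial_pairings (Suc k) ?S. pairing_weight c \<pi>) = ?W (insert (Suc k) ?S) +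
    (\<Sum>s\<in>?S. (if ?S = {s} then 1 else 2) * (c (Suc k) s * ?W (?S - {s})))"
    by (rule sum_pairing_weight_Suc) (use Suc.prems in auto)
  ultimately show ?case unfolding wick.simps annihilate by simp
qed

theorem corollary4p16:
  fixes J :: "'a::complex_hilbert \<Rightarrow> 'a" and m :: nat and x :: "nat \<Rightarrow> 'a"
  assumes "selfadjoint_involution J"
    and "m \<ge> 1"
    and "\<forall>i\<in>{1..2 * m}. J (x i) = x i"
  shows "((\<lambda>q::real. fock_inner J q vacuum
             (foldr (\<lambda>i. gaussian J q (x i)) [1..<2 * m + 1] vacuum))
          \<longlongrightarrow> (\<Sum>\<pi>\<in>pair_partitions (2 * m).
                 2 ^ (m - n_outer \<pi>) * (\<Prod>b\<in>\<pi>. cinner (x (Min b)) (x (Max b)))))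
         (at_left 1)"
proof -
  let ?c = "\<lambda>i j. cinner (x i) (x j)"
  have moment: "fock_inner J q vacuum (foldr (\<lambda>i. gaussian J q (x i)) [1..<2 * m + 1] vacuum) =
      wick ?c q (2 * m) []" for q
    using moment_wick[OF assms(1), of "2 * m" "[]" x q] assms(3)
    by (simp add: moment_def vacuum_def)
  have limit: "wick ?c 1 (2 * m) [] = (\<Sum>\<pi>\<in>pair_partitions (2 * m).
      2 ^ (m - n_outer \<pi>) * (\<Prod>b\<in>\<pi>. ?c (Min b) (Max b)))"
    unfolding wick_eq_sum_pairings[of "[]" "2 * m" ?c, simplified] partial_pairings_full
    by (rule sum.cong[OF refl]) (rule pairing_weight_eq)
  show ?thesis unfolding moment limit[symmetric] by (rule tendsto_wick)
qed

end
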